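(* Let $\alpha\in(0,1)$ be irrational with bounded continued fraction coefficients $(a_n)_{n\in\mathbb N}$. Let $(n_i)_{i\in\mathbb N}$ be a strictly increasing sequence of positive integers such that both limits $$\lim_{i\to\infty}\alpha_{n_i}^+=\lim_{i\to\infty}[a_{n_i};a_{n_i+1},a_{n_i+2},\ldots]\quad\text{and}\quad\lim_{i\to\infty}\alpha_{n_i}^-=\lim_{i\to\infty}[0;a_{n_i-1},a_{n_i-2},\ldots,a_1]$$ exist. Then there exists a constant $C>0$ such that $\lim_{i\to\infty}P_{q_{n_i}}(\alpha)=C$.
   Context: $P_N(\alpha)=\prod_{r=1}^N|2\sin(\pi r\alpha)|$. $\alpha=[0;a_1,a_2,\ldots]$, and its convergent denominators are $q_0=0$, $q_1=1$, $q_{n+1}=a_nq_n+q_{n-1}$. *)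

theory Defs
  imports Complex_Main
begin

text \<open>Gauss-map remainders: cf_rem x 0 = x, cf_rem x (n+1) = frac(1 / cf_rem x n).
  For irrational x in (0,1), cf_rem x (n-1) = [0; a_n, a_(n+1), ...].\<close>
primrec cf_rem :: "real \<Rightarrow> nat \<Rightarrow> real" where
  "cf_rem x 0 = x"
| "cf_rem x (Suc n) = frac (1 / cf_rem x n)"

definition cf_a :: "real \<Rightarrow> nat \<Rightarrow> nat" where
  "cf_a x n = (if n = 0 then 0 else nat \<lfloor>1 / cf_rem x (n - 1)\<rfloor>)"

fun cf_q :: "real \<Rightarrow> nat \<Rightarrow> nat" where
  "cf_q x 0 = 0"
| "cf_q x (Suc 0) = 1"
| "cf_q x (Suc (Suc n)) = cf_a x (Suc n) * cf_q x (Suc n) + cf_q x n"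

fun cfe :: "nat list \<Rightarrow> real" where
  "cfe [] = 0"
| "cfe [b] = real b"
| "cfe (b # c # cs) = real b + 1 / cfe (c # cs)"

definition alpha_plus :: "real \<Rightarrow> nat \<Rightarrow> real" where
  "alpha_plus x n = lim (\<lambda>k. cfe (map (cf_a x) [n..<n + k + 1]))"

definition alpha_minus :: "real \<Rightarrow> nat \<Rightarrow> real" where
  "alpha_minus x n = (if n \<le> 1 then 0 else 1 / cfe (map (cf_a x) (rev [1..<n])))"

definition sine_prod :: "nat \<Rightarrow> real \<Rightarrow> real" where
  "sine_prod N x = (\<Prod>r = 1..N. \<bar>2 * sin (pi * real r * x)\<bar>)"

end

theory Submission
  imports Defs "HOL-Analysis.Analysis"
begin

text \<open>
  Write \<open>q = q_n\<close>, \<open>\<theta> = q_(n-1) / q_n\<close> and \<open>c = q \<bar>q \<alpha> - p_n\<bar> = 1 / (\<alpha>_n^+ + \<alpha>_n^-)\<close>. Reindexing the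
  product by \<open>r = k q_(n-1) mod q\<close> gives
  \<open>P_q(\<alpha>) = 2 sin (\<pi> c / q) \<Prod>k<q. 2 sin (\<pi> (k - c frac (k \<theta>)) / q)\<close>, where the unperturbed
  product equals \<open>q\<close>. After pairing \<open>k\<close> with \<open>q - k\<close>, each factor converges as soon as \<open>c\<close> and \<open>\<theta>\<close>
  do, because the limit of \<open>\<theta>\<close> is irrational. The logarithm of the \<open>k\<close>-th paired factor is
  \<open>2 c (1/2 - frac (k \<theta>)) (\<pi> / q) cot (\<pi> k / q) + O(1 / k^2)\<close>. Since the \<open>\<theta>\<close> are uniformly badly
  approximable, \<open>\<Sum>k\<le>K. 1/2 - frac (k \<theta>)\<close> is \<open>O(sqrt K)\<close> uniformly in \<open>n\<close>, so summation by parts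
  makes the tails uniformly small, and the limit of the logarithms exists and is finite.
\<close>

section \<open>Continued fractions\<close>

text \<open>The indexing follows \<open>cf_q\<close>: index 0 is the formal convergent 1/0 and index
  1 is 0/1, so for n > 0 \<open>cf_p x n / cf_q x n\<close> is the continued fraction cut off just
  before a_n.\<close>

fun cf_p :: "real \<Rightarrow> nat \<Rightarrow> nat" where
  "cf_p x 0 = 1"
| "cf_p x (Suc 0) = 0"
| "cf_p x (Suc (Suc n)) = cf_a x (Suc n) * cf_p x (Suc n) + cf_p x n"

text \<open>\<open>cf_delta x n\<close> is the approximation error \<open>\<bar>q_n x - p_n\<bar>\<close>.\<close>

definition cf_delta :: "real \<Rightarrow> nat \<Rightarrow> real" where
  "cf_delta x n = (\<Prod>j<n. cf_rem x j)"

lemma cf_det: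
  "int (cf_p x (Suc n)) * int (cf_q x n) - int (cf_p x n) * int (cf_q x (Suc n)) = (-1) ^ Suc n"
proof (induction n)
  case (Suc n)
  have "int (cf_p x (Suc (Suc n))) * int (cf_q x (Suc n))
      - int (cf_p x (Suc n)) * int (cf_q x (Suc (Suc n)))
      = - (int (cf_p x (Suc n)) * int (cf_q x n) - int (cf_p x n) * int (cf_q x (Suc n)))"
    by (simp add: algebra_simps)
  then show ?case using Suc by simp
qed simp

lemma coprime_cf_q: "coprime (cf_q x (Suc n)) (cf_q x n)"
proof -
  have "coprime (int (cf_q x (Suc n))) (int (cf_q x n))"
  proof (rule coprimeI)
    fix d assume "d dvd int (cf_q x (Suc n))" "d dvd int (cf_q x n)"
    then have "d dvd (-1) ^ Suc n"
      unfolding cf_det[of x n, symmetric] by (intro dvd_diff dvd_mult)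
    moreover have "((-1) ^ Suc n :: int) dvd 1"
      by (cases "even n") auto
    ultimately show "is_unit d" using dvd_trans by blast
  qed
  then show ?thesis by simp
qed

locale irrational_unit =
  fixes \<alpha> :: real
  assumes pos: "0 < \<alpha>" and less_1: "\<alpha> < 1" and irrational: "\<alpha> \<notin> \<rat>"
begin

lemma cf_rem_irrational: "cf_rem \<alpha> n \<notin> \<rat>"
proof (induction n)
  case (Suc n)
  show ?case
  proof
    assume "cf_rem \<alpha> (Suc n) \<in> \<rat>"
    then have "frac (1 / cf_rem \<alpha> n) + of_int \<lfloor>1 / cf_rem \<alpha> n\<rfloor> \<in> \<rat>"
      by (intro Rats_add) auto
    then have "1 / cf_rem \<alpha> n \<in> \<rat>" by (simp add: frac_def)
    then have "inverse (1 / cf_rem \<alpha> n) \<in> \<rat>" by (rule Rats_inverse)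
    then show False using Suc by simp
  qed
qed (simp add: irrational)

lemma cf_rem_pos: "0 < cf_rem \<alpha> n"
proof (cases n)
  case (Suc m)
  have "cf_rem \<alpha> n \<noteq> 0" using cf_rem_irrational[of n] by auto
  then show ?thesis using Suc frac_ge_0[of "1 / cf_rem \<alpha> m"] by (simp add: less_le del: frac_ge_0)
qed (simp add: pos)

lemma cf_rem_less_1: "cf_rem \<alpha> n < 1"
  by (cases n) (auto simp: less_1 frac_lt_1)

lemma cf_a_Suc: "real (cf_a \<alpha> (Suc n)) = 1 / cf_rem \<alpha> n - cf_rem \<alpha> (Suc n)"
  using cf_rem_pos[of n] by (simp add: cf_a_def frac_def)

lemma cf_a_ge_1: "1 \<le> cf_a \<alpha> (Suc n)"
proof -
  have "1 < 1 / cf_rem \<alpha> n" using cf_rem_pos[of n] cf_rem_less_1[of n] by simp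
  then have "0 < real (cf_a \<alpha> (Suc n))"
    using cf_rem_less_1[of "Suc n"] unfolding cf_a_Suc by linarith
  then show ?thesis by linarith
qed

lemma cf_delta_pos: "0 < cf_delta \<alpha> n"
  by (simp add: cf_delta_def prod_pos cf_rem_pos)

lemma cf_delta_Suc: "cf_delta \<alpha> (Suc n) = cf_rem \<alpha> n * cf_delta \<alpha> n"
  by (simp add: cf_delta_def)

lemma cf_delta_decreasing: "cf_delta \<alpha> (Suc n) < cf_delta \<alpha> n"
  using cf_delta_pos[of n] cf_rem_less_1[of n] by (simp add: cf_delta_Suc)

text \<open>Multiply 1 / x_n = a_(n+1) + x_(n+1), for the remainders x_n, by \<delta>_(n+1) = x_n *
  \<delta>_n. Compared with the recursion of \<open>cf_q\<close> the coefficient changes sign, which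
  makes the signed errors alternate.\<close>

lemma cf_delta_rec:
  "cf_delta \<alpha> (Suc (Suc n)) = cf_delta \<alpha> n - cf_a \<alpha> (Suc n) * cf_delta \<alpha> (Suc n)"
  using cf_rem_pos[of n] by (simp add: cf_delta_Suc[of "Suc n"] cf_delta_Suc[of n] cf_a_Suc field_simps del: cf_rem.simps)

lemma cf_error: "cf_q \<alpha> n * \<alpha> - cf_p \<alpha> n = (-1) ^ Suc n * cf_delta \<alpha> n"
proof (induction n rule: induct_nat_012)
  case (ge2 n)
  have "cf_q \<alpha> (Suc (Suc n)) * \<alpha> - cf_p \<alpha> (Suc (Suc n))
      = cf_a \<alpha> (Suc n) * (cf_q \<alpha> (Suc n) * \<alpha> - cf_p \<alpha> (Suc n)) + (cf_q \<alpha> n * \<alpha> - cf_p \<alpha> n)"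
    by (simp add: algebra_simps)
  also have "\<dots> = (-1) ^ Suc (Suc (Suc n)) * cf_delta \<alpha> (Suc (Suc n))"
    unfolding ge2 by (simp add: cf_delta_rec algebra_simps)
  finally show ?case .
qed (simp_all add: cf_delta_def)

text \<open>The left side is the same for n and n + 1: the recursions of \<open>cf_q\<close> and
  \<open>cf_delta\<close> carry a_(n+1) with opposite signs, so its contributions cancel.\<close>

lemma cf_q_delta: "cf_q \<alpha> (Suc n) * cf_delta \<alpha> n + cf_q \<alpha> n * cf_delta \<alpha> (Suc n) = 1"
proof (induction n)
  case 0 then show ?case by (simp add: cf_delta_def)
next
  case (Suc n)
  then show ?case by (simp add: cf_delta_rec algebra_simps)
qed

lemma cf_q_pos: "0 < cf_q \<alpha> (Suc n)"
proof (induction n)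
  case (Suc n)
  then show ?case using cf_a_ge_1[of n] by simp
qed simp

lemma cf_q_Suc_ge: "cf_q \<alpha> n \<le> cf_q \<alpha> (Suc n)"
proof (cases n)
  case (Suc m)
  then show ?thesis using cf_a_ge_1[of m] mult_le_mono1[of 1 "cf_a \<alpha> (Suc m)" "cf_q \<alpha> (Suc m)"]
    by (simp add: trans_le_add1)
qed simp

text \<open>A crude linear bound suffices both for sending q_n to infinity and for finding a
  denominator beyond any given integer.\<close>

lemma cf_q_ge: "n \<le> cf_q \<alpha> (Suc n)"
proof (induction n rule: less_induct)
  case (less n)
  show ?case
  proof (cases "n \<le> 1")
    case True
    then show ?thesis using cf_q_pos[of n] by linarith
  next
    case False
    then obtain m where m: "n = Suc (Suc m)" by (metis One_nat_def Suc_le_mono le0 not0_implies_Suc)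
    have "Suc m \<le> cf_q \<alpha> (Suc (Suc m))" using less[of "Suc m"] m by blast
    moreover have "cf_q \<alpha> (Suc (Suc m)) \<le> cf_a \<alpha> (Suc (Suc m)) * cf_q \<alpha> (Suc (Suc m))"
      using cf_a_ge_1[of "Suc m"] mult_le_mono1[of 1 "cf_a \<alpha> (Suc (Suc m))" "cf_q \<alpha> (Suc (Suc m))"] by simp
    moreover have "1 \<le> cf_q \<alpha> (Suc m)" using cf_q_pos[of m] by simp
    moreover have "cf_q \<alpha> (Suc n) = cf_a \<alpha> (Suc (Suc m)) * cf_q \<alpha> (Suc (Suc m)) + cf_q \<alpha> (Suc m)"
      unfolding m by simp
    ultimately show ?thesis unfolding m by linarith
  qed
qed

text \<open>Expanding \<open>(d, j)\<close> in the unimodular basis of two consecutive convergents, the bounds on \<open>d\<close> force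
  coefficients of opposite signs, so the two error terms, which alternate in sign, cannot cancel.\<close>

lemma cf_best_approximation:
  assumes "0 < d" "d < int (cf_q \<alpha> (Suc n))" 
  shows "cf_delta \<alpha> n \<le> \<bar>d * \<alpha> - of_int j\<bar>"
proof -
  define s :: int where "s = (-1) ^ Suc n"
  define q q' p p' where qs: "q = int (cf_q \<alpha> n)" "q' = int (cf_q \<alpha> (Suc n))"
    "p = int (cf_p \<alpha> n)" "p' = int (cf_p \<alpha> (Suc n))"
  have ss: "s * s = 1" by (simp add: s_def flip: power_mult_distrib)
  have det: "p' * q - p * q' = s" unfolding qs s_def by (rule cf_det)
  define x where "x = s * (d * p' - j * q')"
  define y where "y = s * (j * q - d * p)"
  have d: "d = x * q + y * q'"
  proof -
    have "x * q + y * q' = s * d * (p' * q - p * q')" unfolding x_def y_def by (simp add: algebra_simps)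
    then show ?thesis using ss det by (simp add: algebra_simps)
  qed
  have j: "j = x * p + y * p'"
  proof -
    have "x * p + y * p' = s * j * (p' * q - p * q')" unfolding x_def y_def by (simp add: algebra_simps)
    then show ?thesis using ss det by (simp add: algebra_simps)
  qed
  have err: "q * \<alpha> - p = s * cf_delta \<alpha> n" "q' * \<alpha> - p' = - s * cf_delta \<alpha> (Suc n)"
    using cf_error[of n] cf_error[of "Suc n"] unfolding qs s_def by simp_all
  have "d * \<alpha> - j = x * (q * \<alpha> - p) + y * (q' * \<alpha> - p')"
    unfolding d j by (simp add: algebra_simps)
  also have "\<dots> = s * (x * cf_delta \<alpha> n - y * cf_delta \<alpha> (Suc n))"
    unfolding err by (simp add: algebra_simps)
  finally have "\<bar>d * \<alpha> - j\<bar> = \<bar>x * cf_delta \<alpha> n - y * cf_delta \<alpha> (Suc n)\<bar>"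
    unfolding s_def by (cases "even n") auto
  note eq = this
  have q: "0 \<le> q" "0 < q'" unfolding qs using cf_q_pos[of n] by auto
  have pos: "0 < cf_delta \<alpha> n" "0 < cf_delta \<alpha> (Suc n)" by (rule cf_delta_pos)+
  have dq: "0 < d" "d < q'" using assms unfolding qs by auto
  consider "1 \<le> x" "y \<le> 0" | "x \<le> -1" "0 \<le> y" 
  proof (cases "0 < y")
    case True
    have "x < 0"
    proof (rule ccontr)
      assume "\<not> x < 0"
      then have "0 \<le> x * q" using q by simp
      moreover have "q' \<le> y * q'" using True q by simp
      ultimately show False using d dq by linarith
    qed
    then show ?thesis using that True by linarith
  next
    case False
    then have "y * q' \<le> 0" using q by (simp add: mult_nonpos_nonneg)
    then have "0 < x * q" using d dq by linarith
    then have "0 < x" using q by (simp add: zero_less_mult_iff)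
    then show ?thesis using that False by linarith
  qed
  then show ?thesis
  proof cases
    case 1
    have "1 * cf_delta \<alpha> n \<le> x * cf_delta \<alpha> n" using 1 pos by (intro mult_right_mono) auto
    moreover have "y * cf_delta \<alpha> (Suc n) \<le> 0" using 1 pos by (simp add: mult_nonpos_nonneg)
    ultimately show ?thesis unfolding eq by linarith
  next
    case 2
    have "x * cf_delta \<alpha> n \<le> (-1) * cf_delta \<alpha> n" using 2 pos by (intro mult_right_mono) auto
    moreover have "0 \<le> y * cf_delta \<alpha> (Suc n)" using 2 pos by simp
    ultimately show ?thesis unfolding eq by linarith
  qed
qed

text \<open>Dividing the recursion of \<open>cf_q\<close> by its middle term gives q_(n+2) / q_(n+1)
  = a_(n+1) + 1 / (q_(n+1) / q_n); unrolling it reads the partial quotients backwards down to a_1.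
  The value 0 at index 1 agrees with q_0 = 0.\<close>

lemma alpha_minus_eq: "alpha_minus \<alpha> (Suc n) = cf_q \<alpha> n / cf_q \<alpha> (Suc n)"
proof (cases n)
  case (Suc m)
  have "cfe (map (cf_a \<alpha>) (rev [1..<Suc (Suc m)])) = cf_q \<alpha> (Suc (Suc m)) / cf_q \<alpha> (Suc m)"
  proof (induction m)
    case (Suc m)
    have rec: "cfe (map (cf_a \<alpha>) (rev [1..<Suc (Suc (Suc m))]))
      = cf_a \<alpha> (Suc (Suc m)) + 1 / cfe (map (cf_a \<alpha>) (rev [1..<Suc (Suc m)]))"
      by simp
    show ?case unfolding rec Suc using cf_q_pos[of "Suc m"]
      by (simp add: field_simps del: cf_q.simps(3)) (simp add: algebra_simps)
  qed simp
  then show ?thesis using Suc by (simp add: alpha_minus_def)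
qed (simp add: alpha_minus_def)

end

section \<open>Bounded partial quotients: bad approximability of \<alpha> and of the ratios q_n /
  q_(n+1)\<close>

locale badly_approximable = irrational_unit +
  fixes B :: nat
  assumes cf_a_le: "\<And>k. cf_a \<alpha> (Suc k) \<le> B"
begin

lemma cf_rem_ge: "1 / (B + 1) \<le> cf_rem \<alpha> n"
proof -
  have "1 / cf_rem \<alpha> n = cf_a \<alpha> (Suc n) + cf_rem \<alpha> (Suc n)" unfolding cf_a_Suc by simp
  also have "\<dots> \<le> B + 1" using cf_a_le[of n] cf_rem_less_1[of "Suc n"] by (simp del: cf_rem.simps)
  finally show ?thesis using cf_rem_pos[of n] by (simp add: field_simps)
qed

text \<open>Truncations and complete quotients obey the same recursion, and one step of it shrinks
  their difference by a factor bounded away from 1. The geometric rate shows that the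
  \<open>lim\<close> in the definition is a genuine limit.\<close>

lemma alpha_plus_eq: "alpha_plus \<alpha> (Suc m) = 1 / cf_rem \<alpha> m"
proof -
  \<comment> \<open>The reciprocal of 1 + 1 / (B + 1), which bounds every complete quotient from
    below: its integer part is at least 1 and its remainder at least 1 / (B + 1).\<close>
  define \<rho> where "\<rho> = (B + 1) / (B + 2 :: real)"
  have \<rho>: "0 \<le> \<rho>" "\<rho> < 1" unfolding \<rho>_def by auto
  define E where "E = (\<lambda>m k. cfe (map (cf_a \<alpha>) [Suc m..<Suc m + k + 1]))"
  have E0: "E m 0 = cf_a \<alpha> (Suc m)" for m unfolding E_def by simp
  have ES: "E m (Suc k) = cf_a \<alpha> (Suc m) + 1 / E (Suc m) k" for m k
  proof -
    have "[Suc m..<Suc m + Suc k + 1] = Suc m # Suc (Suc m) # [Suc (Suc (Suc m))..<Suc (Suc m) + k + 1]"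
      by (simp add: upt_rec del: upt_Suc)
    moreover have "[Suc (Suc m)..<Suc (Suc m) + k + 1] = Suc (Suc m) # [Suc (Suc (Suc m))..<Suc (Suc m) + k + 1]"
      by (simp add: upt_rec del: upt_Suc)
    ultimately show ?thesis unfolding E_def by simp
  qed
  have E_ge: "1 \<le> E m k" for m k
  proof (induction k arbitrary: m)
    case 0
    then show ?case using cf_a_ge_1[of m] by (simp add: E0)
  next
    case (Suc k)
    have "0 \<le> 1 / E (Suc m) k" using Suc[of "Suc m"] by simp
    moreover have "1 \<le> real (cf_a \<alpha> (Suc m))" using cf_a_ge_1[of m] by simp
    ultimately show ?case unfolding ES by linarith
  qed
  have bound: "\<bar>E m k - 1 / cf_rem \<alpha> m\<bar> \<le> \<rho> ^ k" for m k
  proof (induction k arbitrary: m)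
    case 0
    then show ?case using cf_rem_pos[of "Suc m"] cf_rem_less_1[of "Suc m"]
      by (simp add: E0 cf_a_Suc del: cf_rem.simps)
  next
    case (Suc k)
    let ?e = "E (Suc m) k" and ?x = "cf_rem \<alpha> (Suc m)"
    have x: "0 < ?x" "1 \<le> ?e" using cf_rem_pos E_ge by blast+
    have "?x \<le> \<rho>"
    proof -
      have "1 / ?x = cf_a \<alpha> (Suc (Suc m)) + cf_rem \<alpha> (Suc (Suc m))" unfolding cf_a_Suc by simp
      moreover have "1 \<le> real (cf_a \<alpha> (Suc (Suc m)))" using cf_a_ge_1[of "Suc m"] by simp
      ultimately have "1 + 1 / (B + 1) \<le> 1 / ?x" using cf_rem_ge[of "Suc (Suc m)"] by linarith
      then show ?thesis unfolding \<rho>_def using x by (simp add: field_simps del: cf_rem.simps)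
    qed
    have "E m (Suc k) - 1 / cf_rem \<alpha> m = 1 / ?e - ?x" unfolding ES cf_a_Suc by simp
    also have "\<dots> = - (?e - 1 / ?x) * (?x / ?e)" using x by (simp add: field_simps del: cf_rem.simps)
    finally have "\<bar>E m (Suc k) - 1 / cf_rem \<alpha> m\<bar> = \<bar>?e - 1 / ?x\<bar> * (?x / ?e)"
      using x by (simp only: abs_mult abs_minus_cancel) simp
    also have "\<dots> \<le> \<rho> ^ k * \<rho>"
    proof (rule mult_mono)
      have "?x / ?e \<le> ?x" using x by (simp add: divide_le_eq del: cf_rem.simps)
      then show "?x / ?e \<le> \<rho>" using \<open>?x \<le> \<rho>\<close> by linarith
    qed (use Suc[of "Suc m"] \<rho> x in \<open>auto simp del: cf_rem.simps\<close>)
    finally show ?case by (simp only: power_Suc mult.commute)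
  qed
  have "(\<lambda>k. E m k - 1 / cf_rem \<alpha> m) \<longlonglongrightarrow> 0"
    by (rule Lim_null_comparison[of _ "\<lambda>k. \<rho> ^ k"])
      (use bound \<rho> in \<open>auto intro!: always_eventually LIMSEQ_power_zero\<close>)
  then have "E m \<longlonglongrightarrow> 1 / cf_rem \<alpha> m" by (simp add: LIM_zero_iff)
  then show ?thesis unfolding alpha_plus_def E_def by (rule limI)
qed

text \<open>In \<open>cf_q_delta\<close> write \<delta>_m as \<delta>_(m+1) / x_m and factor out
  q_(m+1) * \<delta>_(m+1). Through this formula the two assumed limits determine the limit of the
  perturbation size c.\<close>

lemma cf_q_times_delta:
  "cf_q \<alpha> (Suc m) * cf_delta \<alpha> (Suc m) = 1 / (alpha_plus \<alpha> (Suc m) + alpha_minus \<alpha> (Suc m))"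
proof -
  have "cf_q \<alpha> (Suc m) * (cf_delta \<alpha> (Suc m) / cf_rem \<alpha> m) + cf_q \<alpha> m * cf_delta \<alpha> (Suc m) = 1"
    using cf_q_delta[of m] cf_rem_pos[of m] by (simp add: cf_delta_Suc)
  then have "cf_q \<alpha> (Suc m) * cf_delta \<alpha> (Suc m) * (1 / cf_rem \<alpha> m + cf_q \<alpha> m / cf_q \<alpha> (Suc m)) = 1"
    using cf_q_pos[of m] by (simp add: distrib_left mult.commute)
  moreover from this have "1 / cf_rem \<alpha> m + cf_q \<alpha> m / cf_q \<alpha> (Suc m) \<noteq> 0" by auto
  ultimately show ?thesis unfolding alpha_plus_eq alpha_minus_eq by (simp add: field_simps)
qed

text \<open>Let q_(m+1) be the first denominator exceeding d. Best approximation bounds the distance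
  below by \<delta>_m, which is at least 1 / (2 q_(m+1)) because the first summand of
  \<open>cf_q_delta\<close> dominates, and q_(m+1) <= (B + 1) q_m <= (B + 1) d.\<close>

lemma badly_approximable_alpha:
  assumes "0 < d"
  shows "1 / (2 * (real B + 1)) / d \<le> \<bar>of_int d * \<alpha> - of_int j\<bar>"
proof -
  define m where "m = (LEAST m. d < int (cf_q \<alpha> (Suc m)))"
  have "nat d < cf_q \<alpha> (Suc (Suc (nat d)))" using cf_q_ge[of "Suc (nat d)"] by simp
  then have "d < int (cf_q \<alpha> (Suc (Suc (nat d))))" using assms by linarith
  then have m: "d < int (cf_q \<alpha> (Suc m))" unfolding m_def by (rule LeastI)
  have "m \<noteq> 0" using m assms by (intro notI) simp
  then obtain l where l: "m = Suc l" using not0_implies_Suc by blast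
  have "\<not> d < int (cf_q \<alpha> (Suc l))" using not_less_Least[of l "\<lambda>m. d < int (cf_q \<alpha> (Suc m))"] l
    unfolding m_def by simp
  then have ge: "real (cf_q \<alpha> (Suc l)) \<le> d" by linarith
  have "cf_q \<alpha> (Suc m) \<le> B * cf_q \<alpha> (Suc l) + cf_q \<alpha> (Suc l)"
    unfolding l cf_q.simps using cf_a_le[of l] cf_q_Suc_ge[of l] by (intro add_mono mult_right_mono) auto
  then have "real (cf_q \<alpha> (Suc m)) \<le> real (B * cf_q \<alpha> (Suc l) + cf_q \<alpha> (Suc l))"
    by (rule of_nat_mono)
  then have "real (cf_q \<alpha> (Suc m)) \<le> (real B + 1) * cf_q \<alpha> (Suc l)" by (simp add: algebra_simps)
  also have "\<dots> \<le> (real B + 1) * d" using ge by (intro mult_left_mono) auto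
  finally have le: "real (cf_q \<alpha> (Suc m)) \<le> (real B + 1) * d" .
  have "cf_q \<alpha> m * cf_delta \<alpha> (Suc m) \<le> cf_q \<alpha> (Suc m) * cf_delta \<alpha> m"
    using cf_q_Suc_ge[of m] cf_delta_decreasing[of m] cf_delta_pos[of "Suc m"] by (intro mult_mono) auto
  then have "1 \<le> 2 * cf_q \<alpha> (Suc m) * cf_delta \<alpha> m" using cf_q_delta[of m] by linarith
  also have "\<dots> \<le> 2 * ((real B + 1) * d) * cf_delta \<alpha> m"
    using le cf_delta_pos[of m] by (intro mult_right_mono mult_left_mono) auto
  finally have "1 \<le> cf_delta \<alpha> m * (2 * (real B + 1) * d)" by (simp only: mult_ac)
  moreover have "0 < 2 * (real B + 1) * d" using assms by simp
  ultimately have "1 / (2 * (real B + 1)) / d \<le> cf_delta \<alpha> m"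
    unfolding divide_divide_eq_left by (subst pos_divide_le_eq)
  also have "\<dots> \<le> \<bar>of_int d * \<alpha> - of_int j\<bar>" using cf_best_approximation[OF assms m] .
  finally show ?thesis .
qed

text \<open>With \<open>d = b * q_n - a * q_(n+1)\<close>, the determinant identity turns a good approximation \<open>a / b\<close> of
  \<open>q_n / q_(n+1)\<close> into a small value of the distance of \<open>d * \<alpha>\<close> to the integers.\<close>

lemma badly_approximable_cf_q:
  assumes b: "0 < b" "b < int (cf_q \<alpha> (Suc n))"
  shows "1 / (4 * (real B + 1)) / b \<le> \<bar>of_int b * (cf_q \<alpha> n / cf_q \<alpha> (Suc n)) - of_int a\<bar>"
proof -
  define s :: int where "s = (-1) ^ Suc n"
  define q q' p p' where qs: "q = int (cf_q \<alpha> n)" "q' = int (cf_q \<alpha> (Suc n))"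
    "p = int (cf_p \<alpha> n)" "p' = int (cf_p \<alpha> (Suc n))"
  have det: "p' * q - p * q' = s" unfolding qs s_def by (rule cf_det)
  have abs_s: "\<bar>s\<bar> = 1" unfolding s_def by (simp add: power_abs)
  have q': "0 < q'" "b < q'" unfolding qs using cf_q_pos[of n] b by auto
  define d where "d = b * q - a * q'"
  define j where "j = p * b - p' * a"
  define \<kappa> where "\<kappa> = 1 / (2 * (real B + 1))"
  have \<kappa>: "0 < \<kappa>" "\<kappa> \<le> 1/2" unfolding \<kappa>_def by (auto simp: divide_simps)
  have "d \<noteq> 0"
  proof
    assume "d = 0"
    then have "q' dvd b * q" unfolding d_def by simp
    moreover have "coprime q' q" unfolding qs using coprime_cf_q[of \<alpha> n] by simp
    ultimately have "q' dvd b" using coprime_dvd_mult_left_iff by blast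
    then show False using b q' zdvd_not_zless by blast
  qed
  \<comment> \<open>The integer \<open>j\<close> is chosen so that replacing q' * \<alpha> by p'
    leaves exactly b times the determinant.\<close>
  have key: "q' * (d * \<alpha> - j) = d * (q' * \<alpha> - p') + s * b"
    unfolding d_def j_def det[symmetric] by (simp add: algebra_simps)
  have "q' * (\<kappa> / \<bar>d\<bar>) \<le> q' * \<bar>d * \<alpha> - j\<bar>"
  proof (rule mult_left_mono)
    show "\<kappa> / \<bar>d\<bar> \<le> \<bar>d * \<alpha> - j\<bar>"
    proof (cases "0 < d")
      case True
      then show ?thesis using badly_approximable_alpha[of d j] unfolding \<kappa>_def by (simp add: add.commute)
    next
      case False
      then show ?thesis using badly_approximable_alpha[of "-d" "-j"] \<open>d \<noteq> 0\<close>
        unfolding \<kappa>_def by (simp add: add.commute)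
    qed
  qed (use q' in simp)
  also have "\<dots> = \<bar>q' * (d * \<alpha> - j)\<bar>" using q' by (simp add: abs_mult)
  also have "\<dots> \<le> \<bar>d\<bar> * \<bar>q' * \<alpha> - p'\<bar> + b"
    unfolding key using abs_triangle_ineq[of "d * (q' * \<alpha> - p')" "s * b"] abs_s b
    by (simp add: abs_mult flip: of_int_abs)
  also have "\<bar>q' * \<alpha> - p'\<bar> \<le> 1 / q'"
  proof -
    have "\<bar>q' * \<alpha> - p'\<bar> = cf_delta \<alpha> (Suc n)"
      using cf_error[of "Suc n"] cf_delta_pos[of "Suc n"] unfolding qs by (simp add: abs_mult del: cf_q.simps cf_p.simps)
    moreover have "q' * cf_delta \<alpha> (Suc n) \<le> q' * cf_delta \<alpha> n"
      using cf_delta_decreasing[of n] q' by (intro mult_left_mono) auto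
    moreover have "q' * cf_delta \<alpha> n \<le> 1" using cf_q_delta[of n] cf_delta_pos[of "Suc n"] unfolding qs
      by (smt (verit) mult_nonneg_nonneg of_int_of_nat_eq of_nat_0_le_iff)
    ultimately have "q' * \<bar>q' * \<alpha> - p'\<bar> \<le> 1" by simp
    then show ?thesis using q' by (simp add: pos_le_divide_eq mult.commute)
  qed
  finally have main: "q' * (\<kappa> / \<bar>d\<bar>) \<le> \<bar>d\<bar> * (1 / q') + b" by (simp add: mult_left_mono)
  define D where "D = real_of_int \<bar>d\<bar>"
  have D: "1 \<le> D" unfolding D_def using \<open>d \<noteq> 0\<close> by linarith
  \<comment> \<open>In \<open>main\<close>, multiplied by D, either D * b or D * D / q' must carry
    half of \<kappa> * q'. If D * b does not, then D < \<kappa> * q' / 2, which makes the other term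
    too small as well. This halving turns the constant 2 for \<alpha> into 4.\<close>
  have "\<kappa> / 2 * q' \<le> D * b"
  proof (rule ccontr)
    assume *: "\<not> \<kappa> / 2 * q' \<le> D * b"
    have "q' * \<kappa> \<le> D * D / q' + D * b"
      using mult_right_mono[OF main, of D] D unfolding D_def[symmetric] by (simp add: field_simps)
    then have "\<kappa> / 2 * q' < D * D / q'" using * by argo
    then have 1: "\<kappa> / 2 * (q' * q') < D * D" using q' by (simp add: field_simps)
    have "D * 1 \<le> D * b" using D b by (intro mult_left_mono) auto
    then have D2: "D < \<kappa> / 2 * q'" using * by linarith
    have "D * D \<le> (\<kappa> / 2 * q') * (\<kappa> / 2 * q')" using D D2 by (intro mult_mono) auto
    also have "\<dots> = (\<kappa> / 2) * (\<kappa> / 2 * (q' * q'))" by simp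
    also have "\<dots> \<le> 1 * (\<kappa> / 2 * (q' * q'))" using \<kappa> q' by (intro mult_right_mono) auto
    finally show False using 1 by simp
  qed
  then have "\<kappa> / 2 / b \<le> D / q'" using b q' by (simp add: field_simps)
  also have "D / q' = \<bar>d / q'\<bar>" unfolding D_def using q' by simp
  also have "d / q' = of_int b * (cf_q \<alpha> n / cf_q \<alpha> (Suc n)) - a"
    using q' unfolding d_def qs by (simp add: field_simps del: cf_q.simps)
  finally show ?thesis unfolding \<kappa>_def by simp
qed

end

section \<open>Sums of the sawtooth function\<close>

lemma sum_lessThan_add_nat:
  fixes g :: "nat \<Rightarrow> 'a::comm_monoid_add"
  shows "(\<Sum>k<m + n. g k) = (\<Sum>k<m. g k) + (\<Sum>k<n. g (m + k))"
  by (induction n) (auto simp: add.assoc)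

text \<open>Within a block of length \<open>b\<close> the points are \<open>2 / b\<close>-close to a permutation of \<open>l / b\<close>, except
  that the two extreme residues may wrap around.\<close>

lemma frac_block_sum:
  fixes \<theta> \<phi> :: real and a :: int and b :: nat
  assumes cop: "coprime a (int b)" and b: "0 < b" and approx: "\<bar>b * \<theta> - a\<bar> \<le> 1 / b"
  shows "\<bar>\<Sum>j<b. 1/2 - frac (\<phi> + j * \<theta>)\<bar> \<le> 5"
proof -
  define i f where "i = \<lfloor>b * \<phi>\<rfloor>" and "f = frac (b * \<phi>)"
  \<comment> \<open>The grid cell of width 1 / b into which \<phi> + j * \<theta> would fall if
    \<theta> were a / b; coprimality makes j -> l j a permutation of the cells.\<close>
  define l where "l = (\<lambda>j. nat ((i + int j * a) mod int b))"
  have l_less: "l j < b" for j unfolding l_def using b by (simp add: nat_less_iff)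
  have int_l: "int (l j) = (i + int j * a) mod int b" for j unfolding l_def using b by simp
  have inj: "inj_on l {..<b}"
  proof (rule inj_onI)
    fix j j' assume j: "j \<in> {..<b}" "j' \<in> {..<b}" "l j = l j'"
    then have "(i + int j * a) mod int b = (i + int j' * a) mod int b" by (metis int_l)
    then have "int b dvd (i + int j * a) - (i + int j' * a)" by (simp add: mod_eq_dvd_iff)
    then have "int b dvd (int j - int j') * a" by (simp add: algebra_simps)
    then have "int b dvd int j - int j'" using cop coprime_commute coprime_dvd_mult_left_iff by blast
    then show "j = j'" using j zdvd_imp_le[of "int b" "\<bar>int j - int j'\<bar>"] by (cases "j = j'") auto
  qed
  have "l ` {..<b} = {..<b}" using inj l_less by (intro endo_inj_surj) auto
  then have bij: "bij_betw l {..<b} {..<b}" using inj by (simp add: bij_betw_def)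
  \<comment> \<open>One 1 / b pays for the position inside the cell, the other for the drift j *
    (\<theta> - a / b). In the two extreme cells the drift may cross an integer, so the trivial
    bound 1 is added there. The indicators are additive, so the total is 4 also for b = 1, where the
    extreme cells coincide.\<close>
  define e where "e = (\<lambda>x. 2 / real b + (if x = 0 then 1 else 0) + (if x = b - 1 then 1 else 0))"
  have pointwise: "\<bar>frac (\<phi> + j * \<theta>) - l j / b\<bar> \<le> e (l j)" if j: "j < b" for j
  proof -
    define z where "z = (i + int j * a) div int b"
    define t where "t = j * \<theta> - j * a / b"
    have "b * \<bar>t\<bar> = \<bar>b * t\<bar>" using b by (simp add: abs_mult)
    also have "b * t = j * (b * \<theta> - a)" unfolding t_def using b by (simp add: field_simps)
    also have "\<bar>\<dots>\<bar> \<le> b * (1 / b)" unfolding abs_mult using approx j by (intro mult_mono) auto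
    finally have t: "\<bar>t\<bar> \<le> 1 / b" using b by (simp add: field_simps)
    have f: "0 \<le> f" "f < 1" "b * \<phi> = i + f" unfolding f_def i_def using frac_lt_1 by (auto simp: frac_def)
    have "i + int j * a = int b * z + int (l j)" unfolding int_l z_def by simp
    then have "real_of_int (i + int j * a) = real_of_int (int b * z + int (l j))" by (rule arg_cong)
    then have il: "i + j * a = b * z + real (l j)" by simp
    have "b * (\<phi> + j * \<theta>) = b * (z + ((l j + f) / b + t))"
    proof -
      have "b * (z + ((l j + f) / b + t)) = b * z + b * ((l j + f) / b) + b * t" by (simp add: distrib_left)
      also have "b * ((l j + f) / b) = l j + f" using b by simp
      also have "b * t = j * (b * \<theta>) - j * a" unfolding t_def using b by (simp add: field_simps)
      finally show ?thesis using il f(3) by (simp add: algebra_simps)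
    qed
    then have "\<phi> + j * \<theta> = z + ((l j + f) / b + t)" using b by simp
    then have fr: "frac (\<phi> + j * \<theta>) = frac ((l j + f) / b + t)" by simp
    show ?thesis
    proof (cases "l j = 0 \<or> l j = b - 1")
      case True
      have "0 \<le> real (l j) / b" "real (l j) / b < 1" using l_less[of j] b by auto
      moreover have "0 \<le> frac (\<phi> + j * \<theta>)" "frac (\<phi> + j * \<theta>) < 1" by (auto simp: frac_lt_1)
      ultimately have "\<bar>frac (\<phi> + j * \<theta>) - l j / b\<bar> \<le> 1" by linarith
      moreover have "1 \<le> e (l j)" using True unfolding e_def by auto
      ultimately show ?thesis by linarith
    next
      case False
      then have "1 \<le> l j" "l j + 2 \<le> b" using l_less[of j] by auto
      then have l1: "1 \<le> real (l j)" "real (l j) + 2 \<le> b" by linarith+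
      have "1 / b \<le> real (l j) / b" "(real (l j) + 2) / b \<le> 1" using l1 b by (auto simp: field_simps)
      moreover have "0 \<le> f / b" "f / b < 1 / b" using f b by (auto simp: divide_strict_right_mono)
      ultimately have "0 \<le> (l j + f) / b + t" "(l j + f) / b + t < 1"
        using t by (auto simp: add_divide_distrib)
      then have "frac (\<phi> + j * \<theta>) = (l j + f) / b + t" unfolding fr by (simp add: frac_eq)
      moreover have "0 \<le> f / b" "f / b < 1 / b" by fact+
      ultimately have "\<bar>frac (\<phi> + j * \<theta>) - l j / b\<bar> \<le> 1 / b + 1 / b"
        using t by (simp add: add_divide_distrib)
      then show ?thesis unfolding e_def by auto
    qed
  qed
  have sum_l: "(\<Sum>j<b. real (l j) / b) = (real b - 1) / 2"
  proof -
    have "(\<Sum>j<b. real (l j) / b) = (\<Sum>x<b. real x / b)" by (rule sum.reindex_bij_betw[OF bij])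
    also have "\<dots> = (\<Sum>x<b. real x) / b" by (simp add: sum_divide_distrib)
    also have "(\<Sum>x<b. real x) = b * (real b - 1) / 2"
      by (induction b) (auto simp: field_simps)
    finally show ?thesis using b by simp
  qed
  have sum_e: "(\<Sum>j<b. e (l j)) = 4"
  proof -
    have "(\<Sum>j<b. e (l j)) = (\<Sum>x<b. e x)" by (rule sum.reindex_bij_betw[OF bij])
    also have "\<dots> = 4" unfolding e_def sum.distrib using b by (simp add: sum.delta)
    finally show ?thesis .
  qed
  \<comment> \<open>The exact grid points contribute b / 2 - (b - 1) / 2 = 1/2, so the sum is at
    most 9/2 in absolute value.\<close>
  have "(\<Sum>j<b. 1/2 - frac (\<phi> + j * \<theta>)) = 1/2 - (\<Sum>j<b. frac (\<phi> + j * \<theta>) - l j / b)"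
    unfolding sum_subtractf sum_l by (simp add: diff_divide_distrib)
  moreover have "\<bar>\<Sum>j<b. frac (\<phi> + j * \<theta>) - l j / b\<bar> \<le> (\<Sum>j<b. e (l j))"
    using pointwise by (intro order.trans[OF sum_abs] sum_mono) auto
  ultimately show ?thesis unfolding sum_e by linarith
qed

text \<open>The bound for one block is uniform in the offset, so each further block is a block with
  offset moved by t * b * \<theta>.\<close>

lemma frac_blocks_sum:
  fixes \<theta> \<phi> :: real and a :: int and b :: nat
  assumes "coprime a (int b)" "0 < b" "\<bar>b * \<theta> - a\<bar> \<le> 1 / b"
  shows "\<bar>\<Sum>j<t * b. 1/2 - frac (\<phi> + j * \<theta>)\<bar> \<le> 5 * t"
proof (induction t)
  case (Suc t)
  have "(\<Sum>j<b. 1/2 - frac (\<phi> + real (t * b + j) * \<theta>))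
      = (\<Sum>j<b. 1/2 - frac ((\<phi> + real (t * b) * \<theta>) + j * \<theta>))"
    by (simp add: algebra_simps)
  moreover have "Suc t * b = t * b + b" by simp
  ultimately show ?case
    using order.trans[OF abs_triangle_ineq add_mono[OF Suc frac_block_sum[OF assms, of "\<phi> + real (t * b) * \<theta>"]]]
    by (simp only: sum_lessThan_add_nat of_nat_Suc distrib_left mult_1_right)
qed simp

text \<open>Dirichlet gives an approximation with denominator at most \<open>sqrt K\<close>; bad approximability
  keeps the denominator above a multiple of \<open>sqrt K\<close>, so \<open>O(sqrt K)\<close> blocks suffice.\<close>

lemma frac_sum_bound:
  fixes \<theta> \<kappa> :: real and Q K :: nat
  assumes bad: "\<And>(a::int) (b::int). 0 < b \<Longrightarrow> b < Q \<Longrightarrow> \<kappa> / b \<le> \<bar>b * \<theta> - a\<bar>"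
    and \<kappa>: "0 < \<kappa>" and K: "K < Q"
  shows "\<bar>\<Sum>k=1..K. 1/2 - frac (k * \<theta>)\<bar> \<le> (10 / \<kappa> + 1) * sqrt K"
proof (cases "K = 0")
  case False
  define N where "N = nat \<lfloor>sqrt K\<rfloor>"
  have sqrtK: "1 \<le> sqrt K" using False by simp
  then have "real N = of_int \<lfloor>sqrt K\<rfloor>" "1 \<le> \<lfloor>sqrt K\<rfloor>" unfolding N_def by auto
  then have N: "real N \<le> sqrt K" "sqrt K < N + 1" "1 \<le> N"
    using floor_correct[of "sqrt K"] by linarith+
  have sq: "sqrt K * sqrt K = K" by simp
  have "sqrt K * 1 \<le> sqrt K * sqrt K" using sqrtK by (intro mult_left_mono) auto
  then have "real N \<le> K" using N sq by linarith
  obtain a b where ab: "coprime a b" "0 < b" "b \<le> int N" "\<bar>of_int b * \<theta> - of_int a\<bar> < 1 / N"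
    using Dirichlet_approx_coprime[of N \<theta>] N by auto
  define b' where "b' = nat b"
  have b': "b = int b'" "0 < b'" "b' \<le> N" using ab unfolding b'_def by auto
  have "\<kappa> / b \<le> \<bar>of_int b * \<theta> - of_int a\<bar>" using ab \<open>real N \<le> K\<close> K by (intro bad) auto
  then have "\<kappa> / b' < 1 / N" using ab b' by simp
  then have Nb: "\<kappa> * N < b'" using b' N by (simp add: field_simps)
  have "1 / real N \<le> 1 / real b'" using b' by (simp add: frac_le)
  then have approx: "\<bar>real b' * \<theta> - a\<bar> \<le> 1 / b'" using ab b' by simp
  \<comment> \<open>Full blocks cost 5 each, and the fewer than b' <= sqrt K leftover terms are
    estimated trivially. As b' > \<kappa> * N and sqrt K <= 2 * N, there are at most 2 * sqrt K /
    \<kappa> full blocks.\<close>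
  define t r where "t = K div b'" and "r = K mod b'"
  have Ktr: "K = t * b' + r" unfolding t_def r_def by simp
  have r: "r < b'" unfolding r_def using b' by simp
  have shift: "(\<Sum>k=1..K. 1/2 - frac (k * \<theta>)) = (\<Sum>k<K. 1/2 - frac (\<theta> + k * \<theta>))"
    by (rule sum.reindex_bij_witness[of _ Suc "\<lambda>k. k - 1"]) (auto simp: algebra_simps)
  have "\<bar>\<Sum>k<t * b'. 1/2 - frac (\<theta> + k * \<theta>)\<bar> \<le> 5 * real t"
    using ab b' approx by (intro frac_blocks_sum) auto
  moreover have "\<bar>\<Sum>k<r. 1/2 - frac (\<theta> + real (t * b' + k) * \<theta>)\<bar> \<le> (\<Sum>k<r. 1)"
  proof (intro order.trans[OF sum_abs] sum_mono)
    fix k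
    show "\<bar>1/2 - frac (\<theta> + real (t * b' + k) * \<theta>)\<bar> \<le> 1"
      using frac_ge_0[of "\<theta> + real (t * b' + k) * \<theta>"] frac_lt_1[of "\<theta> + real (t * b' + k) * \<theta>"]
      by linarith
  qed
  moreover have total: "(\<Sum>k=1..K. 1/2 - frac (k * \<theta>)) = (\<Sum>k<t * b'. 1/2 - frac (\<theta> + k * \<theta>))
      + (\<Sum>k<r. 1/2 - frac (\<theta> + real (t * b' + k) * \<theta>))"
    unfolding shift by (subst Ktr) (rule sum_lessThan_add_nat)
  ultimately have "\<bar>\<Sum>k=1..K. 1/2 - frac (k * \<theta>)\<bar> \<le> 5 * real t + r"
    unfolding total by simp
  also have "real r \<le> sqrt K" using r b' N by linarith
  also have "real t \<le> 2 / \<kappa> * sqrt K"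
  proof -
    have "\<kappa> * sqrt K \<le> \<kappa> * (2 * N)" using N \<kappa> by (intro mult_left_mono) auto
    then have "\<kappa> * sqrt K \<le> 2 * b'" using Nb by linarith
    then have "\<kappa> * sqrt K * sqrt K \<le> 2 * b' * sqrt K" by (rule mult_right_mono) simp
    then have "\<kappa> * K \<le> b' * (2 * sqrt K)" using sq by (simp add: mult_ac)
    moreover have "real t * b' \<le> K" using Ktr by (metis le_add1 of_nat_le_iff of_nat_mult)
    then have "\<kappa> * (real t * b') \<le> \<kappa> * K" using \<kappa> by (intro mult_left_mono) auto
    ultimately have "b' * (\<kappa> * t) \<le> b' * (2 * sqrt K)" by (simp add: mult_ac)
    then have "\<kappa> * t \<le> 2 * sqrt K" using b' by simp
    then show ?thesis using \<kappa> by (simp add: field_simps)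
  qed
  finally show ?thesis by (simp add: algebra_simps)
qed simp

text \<open>Summation by parts: partial sums of order sqrt k meet weight increments of order 1 /
  k^2, and the resulting series of k^(-3/2) has tail of order 1 / sqrt M.\<close>

lemma abel_tail_bound:
  fixes x w :: "nat \<Rightarrow> real"
  assumes S: "\<And>k. M \<le> k \<Longrightarrow> k \<le> L \<Longrightarrow> \<bar>\<Sum>j=1..k. x j\<bar> \<le> C * sqrt k"
    and w: "\<And>k. M \<le> k \<Longrightarrow> k \<le> L \<Longrightarrow> \<bar>w k\<bar> \<le> D / k"
    and dw: "\<And>k. M \<le> k \<Longrightarrow> k < L \<Longrightarrow> \<bar>w k - w (Suc k)\<bar> \<le> D / (real k * real (Suc k))"
    and M: "1 \<le> M" "M \<le> L" and nonneg: "0 \<le> C" "0 \<le> D"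
  shows "\<bar>\<Sum>k=Suc M..L. x k * w k\<bar> \<le> 3 * C * D / sqrt M"
proof -
  define S where "S = (\<lambda>k. \<Sum>j=1..k. x j)"
  have end_bound: "\<bar>S k * w k\<bar> \<le> C * D / sqrt k" if "M \<le> k" "k \<le> L" for k
  proof -
    have "\<bar>S k * w k\<bar> \<le> (C * sqrt k) * (D / k)"
      unfolding abs_mult S_def using S[OF that] w[OF that] nonneg by (intro mult_mono) auto
    also have "\<dots> = C * D * (sqrt k / k)" by simp
    also have "sqrt k / k = 1 / sqrt k" using that M real_sqrt_mult_self[of k] by (simp add: field_simps)
    finally show ?thesis by simp
  qed
  \<comment> \<open>With the boundary term removed, each step adds only S k * (w k - w (Suc k)),
    dominated by the telescoping 2 / sqrt k - 2 / sqrt (Suc k). The initial boundary term adds 1 /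
    sqrt M, whence the 3; the final one is absorbed by the negative term.\<close>
  have "k \<le> L \<Longrightarrow> \<bar>(\<Sum>k=Suc M..k. x k * w k) - S k * w k\<bar> \<le> C * D * (3 / sqrt M - 2 / sqrt k)"
    if "M \<le> k" for k
    using that
  proof (induction k rule: dec_induct)
    case base
    show ?case using end_bound[of M] M by (simp add: algebra_simps)
  next
    case (step k)
    have k: "0 < k" "k \<le> L" "k < L" using step M by auto
    have "(\<Sum>k=Suc M..Suc k. x k * w k) - S (Suc k) * w (Suc k)
        = ((\<Sum>k=Suc M..k. x k * w k) - S k * w k) + S k * (w k - w (Suc k))"
      using step by (simp add: S_def algebra_simps)
    moreover have "\<bar>S k * (w k - w (Suc k))\<bar> \<le> (C * sqrt k) * (D / (real k * real (Suc k)))"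
      unfolding abs_mult S_def using S[of k] dw[of k] k step nonneg by (intro mult_mono) auto
    moreover have "(C * sqrt k) * (D / (real k * real (Suc k))) = C * D * (sqrt k / (real k * real (Suc k)))"
      by simp
    moreover have "C * D * (sqrt k / (real k * real (Suc k))) \<le> C * D * (2 / sqrt k - 2 / sqrt (Suc k))"
    proof (rule mult_left_mono)
      define u v where "u = sqrt k" and "v = sqrt (Suc k)"
      have uv: "0 < u" "u \<le> v" "u * u = k" "v * v = Suc k" unfolding u_def v_def using k by auto
      have "(v - u) * (v + u) = 1" using uv by (simp add: algebra_simps)
      moreover have "(v - u) * (v + u) \<le> (v - u) * (2 * v)" using uv by (intro mult_left_mono) auto
      ultimately have "1 \<le> 2 * (v - u) * v" by (simp add: mult_ac)
      then have "1 / (u * (v * v)) \<le> 2 * (v - u) * v / (u * (v * v))" using uv by (intro divide_right_mono) auto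
      also have "\<dots> = 2 / u - 2 / v" using uv(1,2) by (simp add: field_simps)
      finally have "1 / (u * (v * v)) \<le> 2 / u - 2 / v" .
      moreover have "u / (u * u * (v * v)) = 1 / (u * (v * v))" using uv(1) by simp
      ultimately show "sqrt k / (real k * real (Suc k)) \<le> 2 / sqrt k - 2 / sqrt (Suc k)"
        using uv unfolding u_def v_def by simp
    qed (use nonneg in simp)
    ultimately show ?case using step k by (simp add: algebra_simps)
  qed
  from this[of L] have "\<bar>(\<Sum>k=Suc M..L. x k * w k) - S L * w L\<bar> \<le> C * D * (3 / sqrt M - 2 / sqrt L)"
    using M by simp
  moreover have "\<bar>S L * w L\<bar> \<le> C * D / sqrt L" using end_bound[of L] M by simp
  moreover have "C * D * (3 / sqrt M - 2 / sqrt L) + C * D / sqrt L \<le> 3 * C * D / sqrt M"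
    using nonneg by (simp add: algebra_simps)
  ultimately show ?thesis by linarith
qed

section \<open>Products of sines\<close>

text \<open>Evaluate at 1 the factorisation of 1 + z + ... + z^(q-1) over the nontrivial q-th roots
  of unity and take norms, using |1 - cis (2 y)| = 2 |sin y|. The factorisation holds because both
  sides are monic of degree q - 1 and vanish at the same q - 1 points.\<close>

lemma prod_sin_roots_of_unity:
  assumes "0 < q"
  shows "(\<Prod>k=1..q-1. 2 * sin (pi * real k / real q)) = real q"
proof -
  define \<zeta> where "\<zeta> = (\<lambda>k. cis (2 * pi * real k / real q))"
  have bij: "bij_betw \<zeta> {..<q} {z. z ^ q = 1}"
    unfolding \<zeta>_def using Complex.bij_betw_roots_unity[OF assms] .
  have inj: "inj_on \<zeta> {1..q-1}"
    using assms by (intro inj_on_subset[OF bij_betw_imp_inj_on[OF bij]]) auto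
  define P Q where "P = (\<Prod>k=1..q-1. [:- \<zeta> k, 1:])" and "Q = (\<Sum>j<q. monom (1::complex) j)"
  have degP: "degree P = q - 1"
    unfolding P_def by (subst degree_prod_eq_sum_degree) auto
  have lcP: "lead_coeff P = 1" unfolding P_def by (simp add: lead_coeff_prod)
  have coeffQ: "coeff Q k = (if k < q then 1 else 0)" for k
    unfolding Q_def by (simp add: coeff_sum coeff_monom sum.delta)
  have "P = Q"
  proof (rule poly_eqI_degree_lead_coeff)
    show "coeff P (q - 1) = coeff Q (q - 1)" using lcP degP coeffQ assms by simp
    show "q - 1 \<le> card (\<zeta> ` {1..q-1})" using card_image[OF inj] by simp
    show "degree Q \<le> q - 1" by (rule degree_le) (auto simp: coeffQ)
    show "poly P z = poly Q z" if "z \<in> \<zeta> ` {1..q-1}" for z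
    proof -
      obtain k where k: "1 \<le> k" "k \<le> q - 1" "z = \<zeta> k" using \<open>z \<in> _\<close> by auto
      have "z ^ q = 1" using bij k unfolding bij_betw_def by auto
      have "\<zeta> k \<noteq> \<zeta> 0" using bij k unfolding bij_betw_def inj_on_def by fastforce
      then have "z \<noteq> 1" using k unfolding \<zeta>_def by simp
      have "poly Q z = (\<Sum>j<q. z ^ j)" unfolding Q_def by (simp add: poly_sum poly_monom)
      also have "\<dots> = 0" using \<open>z ^ q = 1\<close> \<open>z \<noteq> 1\<close> by (simp add: geometric_sum)
      also have "0 = poly P z" unfolding P_def poly_prod using k by (subst prod_zero) auto
      finally show ?thesis by simp
    qed
  qed (simp_all add: degP)
  then have "poly P 1 = of_nat q" unfolding Q_def by (simp add: poly_sum poly_monom)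
  then have "norm (\<Prod>k=1..q-1. 1 - \<zeta> k) = norm (of_nat q :: complex)"
    unfolding P_def poly_prod by simp
  then have "(\<Prod>k=1..q-1. norm (1 - \<zeta> k)) = q" by (simp only: prod_norm norm_of_nat)
  moreover have "norm (1 - \<zeta> k) = 2 * sin (pi * k / q)" if "k \<in> {1..q-1}" for k
  proof -
    have "0 \<le> sin (pi * k / q)"
      using that assms by (intro sin_ge_zero) (auto simp: field_simps)
    moreover have "norm (1 - cis (2 * (pi * k / q))) = 2 * \<bar>sin (pi * k / q)\<bar>"
    proof -
      define y where "y = pi * k / q"
      have "(norm (1 - cis (2 * y)))\<^sup>2 = (1 - cos (2 * y))\<^sup>2 + (sin (2 * y))\<^sup>2"
        by (simp add: cmod_power2)
      also have "\<dots> = (2 * sin y)\<^sup>2 * ((sin y)\<^sup>2 + (cos y)\<^sup>2)"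
        unfolding cos_double_sin sin_double power2_eq_square
        by (simp add: algebra_simps del: sin_cos_squared_add3)
      also have "\<dots> = (2 * \<bar>sin y\<bar>)\<^sup>2" by (simp add: power_mult_distrib)
      finally show ?thesis unfolding y_def[symmetric] by (rule power2_eq_imp_eq) auto
    qed
    ultimately show ?thesis unfolding \<zeta>_def by (simp add: mult_ac)
  qed
  ultimately show ?thesis by simp
qed

text \<open>A crude constant makes two easy ranges suffice: up to pi / 6 the derivative of sin is at
  least 1/2, and beyond it sin is at least 1/2 while x / 4 is at most pi / 8.\<close>

lemma sin_ge_quarter:
  fixes x :: real
  assumes "0 \<le> x" "x \<le> pi / 2"
  shows "x / 4 \<le> sin x"
proof (cases "x \<le> pi / 6")
  case True
  have "sin 0 - 0 / 4 \<le> sin x - x / 4"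
  proof (rule DERIV_nonneg_imp_nondecreasing[OF assms(1)])
    fix y assume y: "0 \<le> y" "y \<le> x"
    have "cos (pi / 3) \<le> cos y" using y True by (intro cos_monotone_0_pi_le) auto
    then have "0 \<le> cos y - 1 / 4" by (simp add: cos_60)
    moreover have "((\<lambda>x. sin x - x / 4) has_real_derivative cos y - 1 / 4) (at y)"
      by (auto intro!: derivative_eq_intros)
    ultimately show "\<exists>D. ((\<lambda>x. sin x - x / 4) has_real_derivative D) (at y) \<and> 0 \<le> D" by blast
  qed
  then show ?thesis by simp
next
  case False
  have "sin (pi / 6) \<le> sin x" using False assms by (intro sin_monotone_2pi_le) auto
  moreover have "x / 4 \<le> 1 / 2" using assms pi_less_4 by linarith
  ultimately show ?thesis by (simp add: sin_30)
qed

lemma sin_ge_quarter_of_margin: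
  fixes x m :: real
  assumes "0 \<le> m" "m \<le> x" "x \<le> pi - m"
  shows "m / 4 \<le> sin x"
proof (cases "x \<le> pi / 2")
  case True
  then show ?thesis using sin_ge_quarter[of x] assms by simp
next
  case False
  then show ?thesis using sin_ge_quarter[of "pi - x"] assms by simp
qed

section \<open>Uniform estimates for the logarithms of the paired factors\<close>

lemma cot_diff:
  fixes x y :: real
  assumes "sin x \<noteq> 0" "sin y \<noteq> 0"
  shows "cot x - cot y = sin (y - x) / (sin x * sin y)"
  using assms by (simp add: cot_def sin_diff field_simps)

text \<open>The mean value theorem leaves h * (cot (x + t * h) - cot x), and \<open>cot_diff\<close>
  bounds the cotangent difference by |h| / m^2.\<close>

lemma ln_sin_estimate:
  fixes x h m :: real
  assumes m: "0 < m" and sin_ge: "\<And>y. \<bar>y - x\<bar> \<le> \<bar>h\<bar> \<Longrightarrow> m \<le> sin y"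
  shows "\<bar>ln (sin (x + h)) - ln (sin x) - h * cot x\<bar> \<le> (h / m)\<^sup>2"
proof (cases "h = 0")
  case False
  have deriv: "((\<lambda>t. ln (sin (x + t * h))) has_real_derivative h * cot (x + t * h)) (at t)"
    if "0 \<le> t" "t \<le> 1" for t
  proof -
    have "\<bar>x + t * h - x\<bar> \<le> \<bar>h\<bar>" using that by (simp add: abs_mult mult_left_le_one_le)
    then have "0 < sin (x + t * h)" using sin_ge m by fastforce
    then show ?thesis by (auto intro!: derivative_eq_intros simp: cot_def field_simps)
  qed
  obtain t where t: "0 < t" "t < 1"
    "ln (sin (x + 1 * h)) - ln (sin (x + 0 * h)) = (1 - 0) * (h * cot (x + t * h))"
    using MVT2[of 0 1 "\<lambda>t. ln (sin (x + t * h))" "\<lambda>t. h * cot (x + t * h)"] deriv by auto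
  have near: "\<bar>x + t * h - x\<bar> \<le> \<bar>h\<bar>" using t by (simp add: abs_mult mult_left_le_one_le)
  have s: "m \<le> sin (x + t * h)" "m \<le> sin x" using sin_ge near by auto
  have "ln (sin (x + h)) - ln (sin x) - h * cot x = h * (cot (x + t * h) - cot x)"
    using t by (simp add: algebra_simps)
  also have "\<dots> = h * (sin (- (t * h)) / (sin (x + t * h) * sin x))"
    using s m by (subst cot_diff) auto
  also have "\<bar>\<dots>\<bar> \<le> \<bar>h\<bar> * (\<bar>h\<bar> / (m * m))"
    unfolding abs_mult abs_divide
  proof (intro mult_left_mono frac_le)
    show "\<bar>sin (- (t * h))\<bar> \<le> \<bar>h\<bar>"
      using abs_sin_x_le_abs_x[of "t * h"] near by simp
    show "m * m \<le> \<bar>sin (x + t * h)\<bar> * \<bar>sin x\<bar>" using s m by (intro mult_mono) auto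
  qed (use m in auto)
  also have "\<dots> = (h / m)\<^sup>2" by (simp add: power2_eq_square)
  finally show ?thesis .
qed (use m in simp)

text \<open>These are the weight hypotheses of \<open>abel_tail_bound\<close>. Bounding sines below
  by a quarter of the argument cancels q and pi, with one factor 4 for each sine in the
  denominator.\<close>

lemma cot_weight_bounds:
  fixes k q :: nat
  assumes k: "1 \<le> k" "2 * k \<le> q"
  shows "\<bar>pi / q * cot (pi * k / q)\<bar> \<le> 4 / k"
    and "2 * Suc k \<le> q \<Longrightarrow>
      \<bar>pi / q * cot (pi * k / q) - pi / q * cot (pi * Suc k / q)\<bar> \<le> 16 / (real k * real (Suc k))"
proof -
  have q: "0 < real q" using k by auto
  have sin_ge: "pi * j / q / 4 \<le> sin (pi * j / q)" if "2 * j \<le> q" for j :: nat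
  proof (rule sin_ge_quarter)
    have "2 * real j \<le> q" using that by linarith
    then have "pi * (2 * j) \<le> pi * q" by (intro mult_left_mono) auto
    then show "pi * j / q \<le> pi / 2" using q by (simp add: field_simps)
  qed simp
  have pos: "0 < pi * k / q / 4" using k q by simp
  have "\<bar>cot (pi * k / q)\<bar> \<le> 1 / (pi * k / q / 4)"
    unfolding cot_def abs_divide using sin_ge[OF k(2)] pos by (intro frac_le) auto
  then have "pi / q * \<bar>cot (pi * k / q)\<bar> \<le> pi / q * (1 / (pi * k / q / 4))"
    by (intro mult_left_mono) auto
  also have "\<dots> = 4 / k" using q by (simp add: field_simps)
  finally show "\<bar>pi / q * cot (pi * k / q)\<bar> \<le> 4 / k" by (simp add: abs_mult)
  assume k2: "2 * Suc k \<le> q"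
  have pos': "0 < pi * Suc k / q / 4" using q by simp
  have "cot (pi * k / q) - cot (pi * Suc k / q) = sin (pi * Suc k / q - pi * k / q) / (sin (pi * k / q) * sin (pi * Suc k / q))"
    using sin_ge[OF k(2)] sin_ge[OF k2] pos pos' by (intro cot_diff) linarith+
  also have "pi * Suc k / q - pi * k / q = pi / q" by (simp add: distrib_left add_divide_distrib)
  also have "\<bar>sin (pi / q) / (sin (pi * k / q) * sin (pi * Suc k / q))\<bar> \<le> (pi / q) / ((pi * k / q / 4) * (pi * Suc k / q / 4))"
    unfolding abs_divide abs_mult
  proof (rule frac_le)
    show "\<bar>sin (pi / q)\<bar> \<le> pi / q" using abs_sin_x_le_abs_x[of "pi / q"] by simp
    show "(pi * k / q / 4) * (pi * Suc k / q / 4) \<le> \<bar>sin (pi * k / q)\<bar> * \<bar>sin (pi * Suc k / q)\<bar>"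
      using sin_ge[OF k(2)] sin_ge[OF k2] pos pos' by (intro mult_mono) linarith+
    show "0 < (pi * k / q / 4) * (pi * Suc k / q / 4)" using pos pos' by (rule mult_pos_pos)
  qed simp
  finally have "pi / q * \<bar>cot (pi * k / q) - cot (pi * Suc k / q)\<bar>
      \<le> pi / q * ((pi / q) / ((pi * k / q / 4) * (pi * Suc k / q / 4)))"
    by (intro mult_left_mono) auto
  also have "\<dots> = 16 / (real k * real (Suc k))" using q k by (simp add: divide_simps)
  finally show "\<bar>pi / q * cot (pi * k / q) - pi / q * cot (pi * Suc k / q)\<bar> \<le> 16 / (real k * real (Suc k))"
    by (simp only: abs_mult flip: right_diff_distrib) simp
qed

text \<open>The normalised factors \<open>k\<close> and \<open>q - k\<close> of the sine product taken together, using
  \<open>frac (- x) = 1 - frac x\<close>.\<close>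

definition pair_ratio :: "nat \<Rightarrow> real \<Rightarrow> real \<Rightarrow> nat \<Rightarrow> real" where
  "pair_ratio q c u k =
    sin (pi * (k - c * u) / q) * sin (pi * (k + c * (1 - u)) / q) / (sin (pi * k / q))\<^sup>2"

lemma pair_ratio_pos:
  assumes "1 \<le> k" "2 * k \<le> q" "2 \<le> q" "0 \<le> c" "c \<le> 1" "0 < u" "u < 1"
  shows "0 < pair_ratio q c u k"
proof -
  have q: "0 < real q" "2 * real k \<le> q" "1 \<le> real k" "2 \<le> real q" using assms by auto
  have "c * x < 1 \<and> 0 \<le> c * x" if "0 < x" "x < 1" for x
    using order.strict_trans1[OF mult_right_mono[of c 1 x]] that assms by auto
  from this[of u] this[of "1 - u"]
  have cu: "c * u < 1" "c * (1 - u) < 1" "0 \<le> c * u" "0 \<le> c * (1 - u)" using assms by auto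
  have pos: "0 < sin (pi * y / q)" if "y = k - c * u \<or> y = k + c * (1 - u) \<or> y = k" for y :: real
  proof (rule sin_gt_zero)
    have "0 < y \<and> y < q" using that cu q by auto
    then show "0 < pi * y / q" "pi * y / q < pi" using q by (auto simp: pos_divide_less_eq)
  qed
  then show ?thesis unfolding pair_ratio_def by (intro divide_pos_pos mult_pos_pos zero_less_power) auto
qed

text \<open>The displacements - c * u and c * (1 - u) of the two partners add up to 2 * c * (1/2 -
  u), so pairing centres the sawtooth. Each partner contributes a quadratic error 16 / (k -
  1)^2.\<close>

lemma ln_pair_ratio_estimate:
  assumes k: "2 \<le> k" "2 * k \<le> q" and c: "0 \<le> c" "c \<le> 1" and u: "0 < u" "u < 1"
  shows "\<bar>ln (pair_ratio q c u k) - 2 * c * ((1/2 - u) * (pi / q * cot (pi * k / q)))\<bar>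
    \<le> 32 / (real k - 1)\<^sup>2"
proof -
  \<comment> \<open>A displacement of at most pi / q keeps the argument at distance pi * (k - 1) / q
    from 0 and pi; a quarter of this margin is the lower bound \<open>m\<close> for the sines, and
    it is positive because k >= 2.\<close>
  define x h1 h2 m where "x = pi * k / q" and "h1 = - (pi * (c * u) / q)"
    and "h2 = pi * (c * (1 - u)) / q" and "m = pi * (real k - 1) / q / 4"
  have q: "0 < real q" "2 * real k \<le> q" "2 \<le> real k" using k by auto
  have m: "0 < m" using q unfolding m_def by simp
  have "c * u \<le> 1 * 1" "c * (1 - u) \<le> 1 * 1" using c u by (intro mult_mono; simp)+
  then have cu: "c * u \<le> 1" "c * (1 - u) \<le> 1" "0 \<le> c * u" "0 \<le> c * (1 - u)" using c u by auto
  have h: "\<bar>h1\<bar> \<le> pi / q" "\<bar>h2\<bar> \<le> pi / q"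
    using cu q unfolding h1_def h2_def by (auto simp: abs_mult divide_right_mono)
  have sin_ge: "m \<le> sin y" if "\<bar>y - x\<bar> \<le> pi / q" for y
    unfolding m_def
  proof (rule sin_ge_quarter_of_margin)
    have "pi * (real k - 1) / q = x - pi / q" unfolding x_def using q by (simp add: field_simps)
    then show "pi * (real k - 1) / q \<le> y" using that by linarith
    have "pi * (2 * k) \<le> pi * q" using q by (intro mult_left_mono) auto
    then have "x + pi / q \<le> pi - pi * (real k - 1) / q" unfolding x_def using q by (simp add: field_simps)
    then show "y \<le> pi - pi * (real k - 1) / q" using that by linarith
  qed (use q in simp)
  have est: "\<bar>ln (sin (x + h)) - ln (sin x) - h * cot x\<bar> \<le> 16 / (real k - 1)\<^sup>2"
    if "\<bar>h\<bar> \<le> pi / q" for h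
  proof -
    have "\<bar>ln (sin (x + h)) - ln (sin x) - h * cot x\<bar> \<le> (h / m)\<^sup>2"
      using that m by (intro ln_sin_estimate sin_ge) auto
    also have "\<dots> = (\<bar>h\<bar> / m)\<^sup>2" by (simp add: power_divide)
    also have "\<dots> \<le> ((pi / q) / m)\<^sup>2" using that m by (intro power_mono divide_right_mono) auto
    also have "(pi / q) / m = 4 / (real k - 1)" unfolding m_def using q by (simp add: field_simps)
    finally show ?thesis by (simp add: power_divide)
  qed
  have pos: "0 < sin (x + h1)" "0 < sin (x + h2)" "0 < sin x"
    using sin_ge[of "x + h1"] sin_ge[of "x + h2"] sin_ge[of x] h m q by auto
  have "pi * (k - c * u) / q = x + h1" "pi * (k + c * (1 - u)) / q = x + h2"
    unfolding x_def h1_def h2_def by (simp_all add: algebra_simps add_divide_distrib diff_divide_distrib)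
  then have "ln (pair_ratio q c u k) = ln (sin (x + h1) * sin (x + h2) / (sin x)\<^sup>2)"
    unfolding pair_ratio_def x_def by simp
  also have "\<dots> = ln (sin (x + h1)) + ln (sin (x + h2)) - 2 * ln (sin x)"
    using pos by (simp add: ln_div ln_mult ln_realpow)
  finally have ln_eq: "ln (pair_ratio q c u k) = ln (sin (x + h1)) + ln (sin (x + h2)) - 2 * ln (sin x)" .
  have "2 * c * ((1/2 - u) * (pi / q * cot (pi * k / q))) = (h1 + h2) * cot x"
    unfolding h1_def h2_def x_def using q by (simp add: field_simps)
  then have "ln (pair_ratio q c u k) - 2 * c * ((1/2 - u) * (pi / q * cot (pi * k / q)))
    = (ln (sin (x + h1)) - ln (sin x) - h1 * cot x) + (ln (sin (x + h2)) - ln (sin x) - h2 * cot x)"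
    unfolding ln_eq by (simp add: algebra_simps)
  also have "\<bar>\<dots>\<bar> \<le> 16 / (real k - 1)\<^sup>2 + 16 / (real k - 1)\<^sup>2"
    by (rule order.trans[OF abs_triangle_ineq add_mono[OF est[OF h(1)] est[OF h(2)]]])
  finally show ?thesis by simp
qed

text \<open>Compare 1 / l^2 with 2 / (l * (l + 1)), which telescopes.\<close>

lemma inverse_square_tail:
  assumes "1 \<le> M" "M \<le> L"
  shows "(\<Sum>k=Suc M..L. 1 / (real k - 1)\<^sup>2) \<le> 2 / M - 2 / L"
  using assms(2)
proof (induction L rule: dec_induct)
  case (step l)
  then have l: "1 \<le> real l" using assms by simp
  have "1 / (real l)\<^sup>2 = 2 / (real l * (2 * real l))" by (simp add: power2_eq_square)
  also have "\<dots> \<le> 2 / (real l * Suc l)" using l by (intro divide_left_mono mult_left_mono) auto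
  also have "\<dots> = 2 / l - 2 / Suc l" using l by (simp add: field_simps)
  finally have "1 / (real l)\<^sup>2 \<le> 2 / l - 2 / Suc l" .
  then show ?case using step by simp
qed simp

text \<open>The linear terms are handled by \<open>abel_tail_bound\<close> with the sawtooth sums,
  the quadratic errors by \<open>inverse_square_tail\<close>. The bound depends on \<kappa> and M
  alone, which is the uniformity needed to exchange limit and sum.\<close>

lemma ln_pair_ratio_tail:
  fixes \<theta> \<kappa> c :: real and q M L :: nat
  assumes bad: "\<And>(a::int) (b::int). 0 < b \<Longrightarrow> b < q \<Longrightarrow> \<kappa> / b \<le> \<bar>b * \<theta> - a\<bar>"
    and \<kappa>: "0 < \<kappa>" and c: "0 \<le> c" "c \<le> 1" and LM: "1 \<le> M" "2 * L < q"
  shows "\<bar>\<Sum>k=Suc M..L. ln (pair_ratio q c (frac (k * \<theta>)) k)\<bar> \<le> (96 * (10 / \<kappa> + 1) + 64) / sqrt M"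
proof (cases "M \<le> L")
  case True
  define w where "w = (\<lambda>k. pi / q * cot (pi * real k / q))"
  define x where "x = (\<lambda>k. 1/2 - frac (real k * \<theta>))"
  \<comment> \<open>Bad approximability keeps k * \<theta> away from the integers, so the fractional
    part is strictly positive.\<close>
  have frac: "0 < frac (k * \<theta>)" "frac (k * \<theta>) < 1" if "1 \<le> k" "k \<le> L" for k :: nat
  proof -
    have "0 < \<kappa> / k" using \<kappa> that by simp
    also have "\<dots> \<le> \<bar>int k * \<theta> - \<lfloor>k * \<theta>\<rfloor>\<bar>"
      using bad[of "int k" "\<lfloor>k * \<theta>\<rfloor>"] that LM by simp
    finally show "0 < frac (k * \<theta>)" by (simp add: frac_def)
  qed (rule frac_lt_1)
  \<comment> \<open>\<open>abel_tail_bound\<close> takes one constant for both weights and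
    increments, so the weight bound 4 / k is relaxed to 16 / k.\<close>
  have "\<bar>\<Sum>k=Suc M..L. x k * w k\<bar> \<le> 3 * (10 / \<kappa> + 1) * 16 / sqrt M"
  proof (rule abel_tail_bound)
    show "\<bar>\<Sum>j=1..k. x j\<bar> \<le> (10 / \<kappa> + 1) * sqrt k" if "k \<le> L" for k
      unfolding x_def using bad \<kappa> that LM by (intro frac_sum_bound[where Q = q]) auto
    show "\<bar>w k\<bar> \<le> 16 / k" if "M \<le> k" "k \<le> L" for k
    proof -
      have "\<bar>w k\<bar> \<le> 4 / k" unfolding w_def using that LM by (intro cot_weight_bounds) auto
      also have "\<dots> \<le> 16 / k" by (intro divide_right_mono) auto
      finally show ?thesis .
    qed
    show "\<bar>w k - w (Suc k)\<bar> \<le> 16 / (real k * real (Suc k))" if "M \<le> k" "k < L" for k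
      unfolding w_def using that LM by (intro cot_weight_bounds) auto
  qed (use LM True \<kappa> in auto)
  moreover have "\<bar>(\<Sum>k=Suc M..L. ln (pair_ratio q c (frac (k * \<theta>)) k)) - 2 * c * (\<Sum>k=Suc M..L. x k * w k)\<bar> \<le> 64 / sqrt M"
  proof -
    have "\<bar>(\<Sum>k=Suc M..L. ln (pair_ratio q c (frac (k * \<theta>)) k)) - 2 * c * (\<Sum>k=Suc M..L. x k * w k)\<bar>
      = \<bar>\<Sum>k=Suc M..L. ln (pair_ratio q c (frac (k * \<theta>)) k) - 2 * c * (x k * w k)\<bar>"
      by (simp add: sum_subtractf sum_distrib_left)
    also have "\<dots> \<le> (\<Sum>k=Suc M..L. 32 * (1 / (real k - 1)\<^sup>2))"
    proof (intro order.trans[OF sum_abs] sum_mono)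
      fix k assume "k \<in> {Suc M..L}"
      then show "\<bar>ln (pair_ratio q c (frac (k * \<theta>)) k) - 2 * c * (x k * w k)\<bar> \<le> 32 * (1 / (real k - 1)\<^sup>2)"
        unfolding x_def w_def using ln_pair_ratio_estimate[of k q c "frac (k * \<theta>)"] frac[of k] c LM by simp
    qed
    also have "\<dots> \<le> 32 * (2 / M - 2 / L)"
      unfolding sum_distrib_left[symmetric] using inverse_square_tail[of M L] LM True by (intro mult_left_mono) auto
    also have "\<dots> \<le> 64 / M" by simp
    also have "\<dots> \<le> 64 / sqrt M"
    proof -
      have "sqrt M * 1 \<le> sqrt M * sqrt M" using LM by (intro mult_left_mono) auto
      then show ?thesis using LM by (intro divide_left_mono) auto
    qed
    finally show ?thesis .
  qed
  moreover have "\<bar>2 * c * (\<Sum>k=Suc M..L. x k * w k)\<bar> \<le> 2 * (3 * (10 / \<kappa> + 1) * 16 / sqrt M)"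
    unfolding abs_mult using calculation(1) c by (intro mult_mono) auto
  ultimately have "\<bar>\<Sum>k=Suc M..L. ln (pair_ratio q c (frac (k * \<theta>)) k)\<bar>
      \<le> 2 * (3 * (10 / \<kappa> + 1) * 16 / sqrt M) + 64 / sqrt M" by linarith
  also have "\<dots> = (96 * (10 / \<kappa> + 1) + 64) / sqrt M" by (simp add: add_divide_distrib)
  finally show ?thesis .
qed (use \<kappa> in auto)

section \<open>Limits of single factors, and of sums with uniformly small tails\<close>

lemma tendsto_scaled_sin:
  fixes q z :: "nat \<Rightarrow> real"
  assumes q: "filterlim q at_top sequentially" and z: "z \<longlonglongrightarrow> l"
  shows "(\<lambda>i. q i * sin (pi * z i / q i)) \<longlonglongrightarrow> pi * l"
proof -
  \<comment> \<open>Filling the removable singularity covers indices with z i = 0 as well.\<close>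
  define S where "S = (\<lambda>t::real. if t = 0 then 1 else sin t / t)"
  have "(\<lambda>h::real. sin h / h) \<midarrow>0\<rightarrow> 1" using DERIV_sin[of 0] by (simp add: DERIV_def)
  then have "S \<midarrow>0\<rightarrow> 1"
    by (rule Lim_transform_eventually) (auto simp: S_def eventually_at_filter)
  then have "isCont S 0" by (simp add: isCont_def S_def)
  moreover have inv: "(\<lambda>i. inverse (q i)) \<longlonglongrightarrow> 0" by (rule tendsto_inverse_0_at_top[OF q])
  have "(\<lambda>i. pi * z i * inverse (q i)) \<longlonglongrightarrow> pi * l * 0" by (intro tendsto_intros z inv)
  then have "(\<lambda>i. pi * z i / q i) \<longlonglongrightarrow> 0" by (simp add: divide_inverse)
  ultimately have "(\<lambda>i. S (pi * z i / q i)) \<longlonglongrightarrow> S 0" by (rule isCont_tendsto_compose)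
  then have "(\<lambda>i. pi * z i * S (pi * z i / q i)) \<longlonglongrightarrow> pi * l * 1"
    by (intro tendsto_mult tendsto_const z) (simp add: S_def)
  moreover have "\<forall>\<^sub>F i in sequentially. pi * z i * S (pi * z i / q i) = q i * sin (pi * z i / q i)"
    using filterlim_at_top_dense[THEN iffD1, OF q, rule_format, of 0]
    by eventually_elim (auto simp: S_def)
  ultimately show ?thesis using Lim_transform_eventually by fastforce
qed

text \<open>Numerator and denominator each contain two sines, so every sine may be scaled by q. The
  limit of the ratio is (k - c' * u') * (k + c' * (1 - u')) / k^2, and the strict inequality u' < 1
  keeps it positive even for k = c' = 1.\<close>

lemma convergent_ln_pair_ratio:
  fixes q :: "nat \<Rightarrow> nat"
  assumes q: "filterlim q at_top sequentially" and c: "c \<longlonglongrightarrow> c'" "0 \<le> c'" "c' \<le> 1"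
    and u: "u \<longlonglongrightarrow> u'" "0 \<le> u'" "u' < 1" and k: "1 \<le> k"
  shows "convergent (\<lambda>i. ln (pair_ratio (q i) (c i) (u i) k))"
proof -
  have q': "filterlim (\<lambda>i. real (q i)) at_top sequentially"
    by (rule filterlim_compose[OF filterlim_real_sequentially q])
  define A B D where "A = (\<lambda>i. q i * sin (pi * (k - c i * u i) / q i))"
    and "B = (\<lambda>i. q i * sin (pi * (k + c i * (1 - u i)) / q i))"
    and "D = (\<lambda>i. q i * sin (pi * k / q i))"
  have lims: "A \<longlonglongrightarrow> pi * (k - c' * u')" "B \<longlonglongrightarrow> pi * (k + c' * (1 - u'))" "D \<longlonglongrightarrow> pi * k"
    unfolding A_def B_def D_def by (intro tendsto_scaled_sin[OF q'] tendsto_intros c u)+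
  have "c' * u' \<le> 1 * u'" using c u by (intro mult_right_mono) auto
  then have pos: "0 < k - c' * u'" "0 < k + c' * (1 - u')" using c u k by (auto intro: add_pos_nonneg)
  have "(\<lambda>i. ln (A i * B i / (D i)\<^sup>2)) \<longlonglongrightarrow> ln (pi * (k - c' * u') * (pi * (k + c' * (1 - u'))) / (pi * k)\<^sup>2)"
    using pos k by (intro tendsto_ln tendsto_divide tendsto_mult tendsto_power lims) auto
  moreover have "\<forall>\<^sub>F i in sequentially. ln (A i * B i / (D i)\<^sup>2) = ln (pair_ratio (q i) (c i) (u i) k)"
    using filterlim_at_top_dense[THEN iffD1, OF q', rule_format, of 0]
    by eventually_elim (auto simp: A_def B_def D_def pair_ratio_def power2_eq_square)
  ultimately show ?thesis using Lim_transform_eventually convergent_def by fast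
qed

text \<open>A Cauchy argument with a fixed cut M: the heads of two sums differ by less than e / 2,
  and each tail is below e / 4 once the varying length L i has passed M.\<close>

lemma convergent_sum_uniform_tails:
  fixes f :: "nat \<Rightarrow> nat \<Rightarrow> real"
  assumes conv: "\<And>k. 1 \<le> k \<Longrightarrow> convergent (\<lambda>i. f i k)"
    and L: "filterlim L at_top sequentially"
    and tails: "\<And>M. 1 \<le> M \<Longrightarrow> \<forall>\<^sub>F i in sequentially. \<bar>\<Sum>k=Suc M..L i. f i k\<bar> \<le> T M"
    and T: "T \<longlonglongrightarrow> 0"
  shows "convergent (\<lambda>i. \<Sum>k=1..L i. f i k)"
proof (rule Cauchy_convergent, rule metric_CauchyI)
  fix e :: real assume e: "0 < e"
  have "\<forall>\<^sub>F M in sequentially. T M < e / 4 \<and> 1 \<le> M"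
    using T e by (intro eventually_conj order_tendstoD(2)[OF T] eventually_ge_at_top) auto
  then obtain M where M: "T M < e / 4" "1 \<le> M"
    using eventually_happens'[OF sequentially_bot] by blast
  have "convergent (\<lambda>i. \<Sum>k=1..M. f i k)" by (intro convergent_sum conv) auto
  then have "Cauchy (\<lambda>i. \<Sum>k=1..M. f i k)" by (rule convergent_Cauchy)
  then obtain I where I: "\<And>i j. i \<ge> I \<Longrightarrow> j \<ge> I \<Longrightarrow> \<bar>(\<Sum>k=1..M. f i k) - (\<Sum>k=1..M. f j k)\<bar> < e / 2"
    unfolding Cauchy_def dist_real_def using e by (meson half_gt_zero)
  have "\<forall>\<^sub>F i in sequentially. M \<le> L i \<and> \<bar>\<Sum>k=Suc M..L i. f i k\<bar> \<le> T M"
    using L M tails by (intro eventually_conj) (auto simp: filterlim_at_top)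
  then obtain J where J: "\<And>i. i \<ge> J \<Longrightarrow> M \<le> L i \<and> \<bar>\<Sum>k=Suc M..L i. f i k\<bar> \<le> T M"
    unfolding eventually_sequentially by auto
  have split: "(\<Sum>k=1..L i. f i k) = (\<Sum>k=1..M. f i k) + (\<Sum>k=Suc M..L i. f i k)" if "i \<ge> J" for i
    using J[OF that] M sum.ub_add_nat[of 1 M "f i" "L i - M"] by simp
  show "\<exists>N. \<forall>m\<ge>N. \<forall>n\<ge>N. dist (\<Sum>k=1..L m. f m k) (\<Sum>k=1..L n. f n k) < e"
  proof (intro exI allI impI)
    fix i j assume "max I J \<le> i" "max I J \<le> j"
    then have "i \<ge> I" "j \<ge> I" "i \<ge> J" "j \<ge> J" by auto
    then show "dist (\<Sum>k=1..L i. f i k) (\<Sum>k=1..L j. f j k) < e"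
      unfolding dist_real_def using I[of i j] J[of i] J[of j] split[of i] split[of j] M(1) by linarith
  qed
qed

text \<open>The reflection k -> q - k has a fixed point only for even q, namely q / 2, which gives
  the leftover factor.\<close>

lemma prod_pairing:
  fixes f :: "nat \<Rightarrow> 'a::comm_monoid_mult"
  assumes "0 < q"
  shows "(\<Prod>k=1..q-1. f k) =
    (\<Prod>k=1..(q-1) div 2. f k * f (q - k)) * (if even q then f (q div 2) else 1)"
proof -
  define L where "L = (q - 1) div 2"
  have L: "1 \<le> L + 1" "L + 1 \<le> q - L" "q - L \<le> q" using assms unfolding L_def by auto
  have "(\<Prod>k=1..q-1. f k) = (\<Prod>k\<in>{1..<q}. f k)" using assms by (intro prod.cong) auto
  also have "\<dots> = (\<Prod>k\<in>{1..<L+1}. f k) * (\<Prod>k\<in>{L+1..<q-L}. f k) * (\<Prod>k\<in>{q-L..<q}. f k)"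
    by (simp only: prod.atLeastLessThan_concat[OF L(1,2)] prod.atLeastLessThan_concat[OF order.trans[OF L(1,2)] L(3)])
  also have "(\<Prod>k\<in>{L+1..<q-L}. f k) = (if even q then f (q div 2) else 1)"
  proof (cases "even q")
    case True
    then have "{L+1..<q-L} = {q div 2}" using assms unfolding L_def by (auto elim!: evenE)
    then show ?thesis using True by simp
  next
    case False
    then have "{L+1..<q-L} = {}" unfolding L_def by (auto elim!: oddE)
    then show ?thesis using False by simp
  qed
  also have "(\<Prod>k\<in>{q-L..<q}. f k) = (\<Prod>k\<in>{1..L}. f (q - k))"
    using L assms by (intro prod.reindex_bij_witness[of _ "\<lambda>k. q - k" "\<lambda>k. q - k"]) auto
  also have "{1..<L+1} = {1..L}" by auto
  finally show ?thesis unfolding L_def[symmetric] prod.distrib by (simp add: mult_ac)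
qed

section \<open>Sudler products at convergent denominators\<close>

lemma abs_sin_add_int_pi: "\<bar>sin (pi * (of_int z + x))\<bar> = \<bar>sin (pi * x)\<bar>" for x :: real
  by (simp add: distrib_left sin_add abs_mult)

lemma bij_betw_mult_mod:
  fixes a q :: nat
  assumes "coprime q a"
  shows "bij_betw (\<lambda>k. k * a mod q) {1..q-1} {1..q-1}"
proof -
  have inj: "inj_on (\<lambda>k. k * a mod q) {1..q-1}"
  proof (rule inj_onI)
    fix k l assume kl: "k \<in> {1..q-1}" "l \<in> {1..q-1}" "k * a mod q = l * a mod q"
    then have "int (k * a) mod int q = int (l * a) mod int q" by (metis of_nat_mod)
    then have "int q dvd (int k - int l) * int a" by (simp add: mod_eq_dvd_iff left_diff_distrib)
    moreover have "coprime (int q) (int a)" using assms by simp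
    ultimately have "int q dvd int k - int l" using coprime_dvd_mult_left_iff by blast
    then show "k = l" using kl zdvd_imp_le[of "int q" "\<bar>int k - int l\<bar>"] by (cases "k = l") auto
  qed
  have "(\<lambda>k. k * a mod q) ` {1..q-1} \<subseteq> {1..q-1}"
  proof (rule image_subsetI)
    fix k assume k: "k \<in> {1..q-1}"
    then have "\<not> q dvd k" using dvd_imp_le[of q k] by auto
    then have "\<not> q dvd k * a" using assms by (simp add: coprime_dvd_mult_left_iff)
    moreover have "k * a mod q < q" using k by (intro mod_less_divisor) auto
    ultimately show "k * a mod q \<in> {1..q-1}" by (auto simp: dvd_eq_mod_eq_0 Suc_le_eq)
  qed
  then show ?thesis using inj by (simp add: bij_betw_def endo_inj_surj)
qed

context irrational_unit
begin

lemma cf_q_delta_bounds: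
  shows "0 < cf_q \<alpha> (Suc n) * cf_delta \<alpha> (Suc n)" "cf_q \<alpha> (Suc n) * cf_delta \<alpha> (Suc n) < 1"
proof -
  show "0 < cf_q \<alpha> (Suc n) * cf_delta \<alpha> (Suc n)" using cf_q_pos[of n] cf_delta_pos[of "Suc n"] by simp
  have "cf_q \<alpha> (Suc n) * cf_delta \<alpha> (Suc n) < cf_q \<alpha> (Suc n) * cf_delta \<alpha> n"
    using cf_q_pos[of n] cf_delta_decreasing[of n] by (intro mult_strict_left_mono) auto
  moreover have "0 \<le> cf_q \<alpha> n * cf_delta \<alpha> (Suc n)" using cf_delta_pos[of "Suc n"] by simp
  ultimately show "cf_q \<alpha> (Suc n) * cf_delta \<alpha> (Suc n) < 1" using cf_q_delta[of n] by linarith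
qed

text \<open>The substitution \<open>r = k * q_n mod q_(n+1)\<close> makes \<open>r * p_(n+1)\<close> congruent to \<open>\<plusminus> k\<close>; the
  perturbation of \<open>k\<close> then has the opposite sign for both parities of \<open>n\<close>.\<close>

lemma sine_prod_cf_q:
  fixes n :: nat
  defines "q \<equiv> cf_q \<alpha> (Suc n)"
  defines "\<theta> \<equiv> cf_q \<alpha> n / q"
    and "c \<equiv> q * cf_delta \<alpha> (Suc n)"
  shows "sine_prod q \<alpha> = 2 * sin (pi * c / q) *
    (\<Prod>k=1..q-1. 2 * sin (pi * (real k - c * frac (real k * \<theta>)) / q))"
proof -
  define \<delta> where "\<delta> = cf_delta \<alpha> (Suc n)"
  define s :: int where "s = (-1) ^ Suc (Suc n)"
  define p p' q' where "p = int (cf_p \<alpha> (Suc n))" and "p' = int (cf_p \<alpha> n)" and "q' = cf_q \<alpha> n"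
  have q: "0 < q" unfolding q_def by (rule cf_q_pos)
  have c: "0 < c" "c < 1" unfolding c_def q_def by (rule cf_q_delta_bounds)+
  have s: "s = 1 \<or> s = -1" unfolding s_def by (cases "even n") auto
  have det: "p * int q' - p' * int q = - s"
    using cf_det[of \<alpha> n] unfolding p_def p'_def q'_def q_def s_def by (simp del: cf_q.simps cf_p.simps)
  have error: "q * \<alpha> = p + s * \<delta>"
    using cf_error[of "Suc n"] unfolding q_def p_def s_def \<delta>_def by (simp del: cf_q.simps cf_p.simps)
  have sin_s: "\<bar>sin (pi * (- s * y))\<bar> = \<bar>sin (pi * y)\<bar>" for y :: real using s by auto
  have \<delta>: "\<delta> = c / q" unfolding c_def \<delta>_def using q by simp
  have sin_cq: "0 < sin (pi * y / q)" if "0 < y" "y < q" for y :: real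
    using that q by (intro sin_gt_zero) (auto simp: pos_divide_less_eq)
  have "sine_prod q \<alpha> = \<bar>2 * sin (pi * real q * \<alpha>)\<bar> * (\<Prod>r=1..q-1. \<bar>2 * sin (pi * real r * \<alpha>)\<bar>)"
  proof -
    have "{1..q} = insert q {1..q-1}" using q by auto
    then show ?thesis unfolding sine_prod_def using q by simp
  qed
  also have "\<bar>2 * sin (pi * real q * \<alpha>)\<bar> = 2 * sin (pi * c / q)"
  proof -
    have "pi * real q * \<alpha> = pi * (of_int p + s * \<delta>)" using error by (simp add: mult.assoc)
    then have "\<bar>sin (pi * real q * \<alpha>)\<bar> = \<bar>sin (pi * (s * \<delta>))\<bar>" by (simp only: abs_sin_add_int_pi)
    also have "\<dots> = \<bar>sin (pi * c / q)\<bar>" using s unfolding \<delta> by auto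
    also have "\<dots> = sin (pi * c / q)" using sin_cq[of c] c q by simp
    finally show ?thesis by (simp add: abs_mult)
  qed
  also have "(\<Prod>r=1..q-1. \<bar>2 * sin (pi * real r * \<alpha>)\<bar>)
      = (\<Prod>k=1..q-1. \<bar>2 * sin (pi * real (k * q' mod q) * \<alpha>)\<bar>)"
    by (rule prod.reindex_bij_betw[symmetric], rule bij_betw_mult_mod)
      (simp add: q_def q'_def coprime_cf_q)
  also have "\<dots> = (\<Prod>k=1..q-1. 2 * sin (pi * (real k - c * frac (real k * \<theta>)) / q))"
  proof (rule prod.cong[OF refl])
    fix k assume k: "k \<in> {1..q-1}"
    define r m where "r = k * q' mod q" and "m = k * q' div q"
    have "k * q' = m * q + r" unfolding r_def m_def by simp
    then have kq: "real k * real q' = m * real q + r" by (metis of_nat_add of_nat_mult)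
    have k\<theta>: "k * \<theta> = of_int (int m) + r / q"
      unfolding \<theta>_def q'_def[symmetric] using kq q by (simp add: field_simps)
    have "0 \<le> real r / q" "real r / q < 1" unfolding r_def using q by auto
    then have "frac (k * \<theta>) = r / q" unfolding k\<theta> frac_add_of_int_left by (simp only: frac_eq)
    then have cf: "c * frac (k * \<theta>) = r * \<delta>" unfolding \<delta> by simp
    have "r * \<delta> < 1"
    proof -
      have "c * frac (k * \<theta>) < 1 * 1" using c frac_lt_1[of "k * \<theta>"] by (intro mult_strict_mono') auto
      then show ?thesis using cf by simp
    qed
    moreover have "0 \<le> r * \<delta>" using cf[symmetric] c by simp
    moreover have "1 \<le> real k" "real k \<le> real q - 1" using k q by auto
    ultimately have y: "0 < k - r * \<delta>" "k - r * \<delta> < q" by linarith+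
    define z where "z = int k * p' - int m * p"
    have detr: "p * real q' = p' * real q - s"
    proof -
      have "real_of_int (p * int q' - p' * int q) = real_of_int (- s)" unfolding det by simp
      then show ?thesis by simp
    qed
    have "r * real_of_int p = k * (p * real q') - m * real q * p" using kq by (simp add: algebra_simps)
    then have rp: "r * real_of_int p = q * z - k * s" unfolding detr z_def by (simp add: algebra_simps)
    have "q * (r * \<alpha>) = r * (q * \<alpha>)" by simp
    also have "\<dots> = q * z - s * (k - r * \<delta>)" unfolding error distrib_left rp by (simp add: algebra_simps)
    finally have "r * \<alpha> = z + (- s * ((k - r * \<delta>) / q))" using q by (simp add: field_simps)
    then have "pi * real r * \<alpha> = pi * (of_int z + (- s * ((k - r * \<delta>) / q)))" by simp
    then have "\<bar>sin (pi * real r * \<alpha>)\<bar> = \<bar>sin (pi * (- s * ((k - r * \<delta>) / q)))\<bar>"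
      by (simp only: abs_sin_add_int_pi)
    also have "\<dots> = \<bar>sin (pi * ((k - r * \<delta>) / q))\<bar>" by (rule sin_s)
    also have "\<dots> = sin (pi * (k - r * \<delta>) / q)" using sin_cq[OF y] by (simp only: times_divide_eq_right)
    finally show "\<bar>2 * sin (pi * real (k * q' mod q) * \<alpha>)\<bar> = 2 * sin (pi * (k - c * frac (k * \<theta>)) / q)"
      unfolding cf r_def[symmetric] by (simp add: abs_mult)
  qed
  finally show ?thesis .
qed

text \<open>Dividing by the unperturbed product releases a factor q, which is joined to sin (pi * c
  / q) so that their product has a finite positive limit. For even q the unpaired factor has
  unperturbed sine 1 and turns into a cosine.\<close>

lemma sine_prod_cf_q_pairing:
  fixes n :: nat
  defines "q \<equiv> cf_q \<alpha> (Suc n)"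
  defines "\<theta> \<equiv> cf_q \<alpha> n / q"
    and "c \<equiv> q * cf_delta \<alpha> (Suc n)"
  shows "sine_prod q \<alpha> = 2 * (q * sin (pi * c / q)) *
    ((\<Prod>k=1..(q-1) div 2. pair_ratio q c (frac (k * \<theta>)) k) *
     (if even q then cos (pi * (c * frac (real (q div 2) * \<theta>)) / q) else 1))"
proof -
  have q: "0 < q" unfolding q_def by (rule cf_q_pos)
  define f where "f = (\<lambda>k. sin (pi * (real k - c * frac (real k * \<theta>)) / q) / sin (pi * real k / q))"
  have sin_pos: "0 < sin (pi * real k / q)" if "k \<in> {1..q-1}" for k
    using that q by (intro sin_gt_zero) (auto simp: pos_divide_less_eq)
  have "(\<Prod>k=1..q-1. 2 * sin (pi * (real k - c * frac (real k * \<theta>)) / q))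
      = (\<Prod>k=1..q-1. (2 * sin (pi * real k / q)) * f k)"
    using sin_pos by (intro prod.cong refl) (simp add: f_def less_le)
  also have "\<dots> = q * (\<Prod>k=1..q-1. f k)"
    using prod_sin_roots_of_unity[OF q] by (simp only: prod.distrib)
  also have "(\<Prod>k=1..q-1. f k) =
      (\<Prod>k=1..(q-1) div 2. f k * f (q - k)) * (if even q then f (q div 2) else 1)"
    by (rule prod_pairing[OF q])
  also have "(\<Prod>k=1..(q-1) div 2. f k * f (q - k)) = (\<Prod>k=1..(q-1) div 2. pair_ratio q c (frac (k * \<theta>)) k)"
  proof (rule prod.cong[OF refl])
    fix k assume k: "k \<in> {1..(q-1) div 2}"
    have real_sub: "real (q - k) = real q - real k" using k by (intro of_nat_diff) auto
    \<comment> \<open>The reflection frac (- x) = 1 - frac x fails at integers, which coprimality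
      excludes for 0 < k < q.\<close>
    have "real k * \<theta> \<notin> \<int>"
    proof
      assume "real k * \<theta> \<in> \<int>"
      then obtain z where "real k * \<theta> = of_int z" by (auto elim: Ints_cases)
      then have "real_of_int (int k * int (cf_q \<alpha> n)) = real_of_int (z * int q)"
        unfolding \<theta>_def using q by (simp add: field_simps)
      then have "int k * int (cf_q \<alpha> n) = z * int q" by (simp only: of_int_eq_iff)
      then have "int q dvd int k * int (cf_q \<alpha> n)" by simp
      moreover have "coprime (int q) (int (cf_q \<alpha> n))" unfolding q_def using coprime_cf_q by simp
      ultimately have "int q dvd int k" using coprime_dvd_mult_left_iff by blast
      then show False using k q by (auto dest: dvd_imp_le)
    qed
    moreover have "real q * \<theta> = of_int (int (cf_q \<alpha> n))" unfolding \<theta>_def using q by simp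
    then have "frac (real (q - k) * \<theta>) = frac (- (real k * \<theta>))"
      unfolding real_sub left_diff_distrib by (metis add_uminus_conv_diff frac_add_of_int_left)
    ultimately have u: "frac (real (q - k) * \<theta>) = 1 - frac (real k * \<theta>)" by (simp add: frac_neg)
    have "pi * (real (q - k) - c * frac (real (q - k) * \<theta>)) / q = pi - pi * (k + c * (1 - frac (k * \<theta>))) / q"
      unfolding u unfolding real_sub using q by (simp add: field_simps)
    moreover have "pi * real (q - k) / q = pi - pi * k / q" unfolding real_sub using q by (simp add: field_simps)
    ultimately have "f (q - k) = sin (pi * (k + c * (1 - frac (k * \<theta>))) / q) / sin (pi * k / q)"
      unfolding f_def by (simp only: sin_pi_minus)
    then show "f k * f (q - k) = pair_ratio q c (frac (k * \<theta>)) k"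
      unfolding pair_ratio_def f_def by (simp add: power2_eq_square)
  qed
  also have "(if even q then f (q div 2) else 1) = (if even q then cos (pi * (c * frac (real (q div 2) * \<theta>)) / q) else 1)"
  proof (cases "even q")
    case True
    then have half: "real (q div 2) = q / 2" by (metis real_of_nat_div of_nat_numeral)
    from this have eqs: "pi * (real (q div 2) - c * frac (real (q div 2) * \<theta>)) / q
        = pi / 2 - pi * (c * frac (real (q div 2) * \<theta>)) / q" "pi * real (q div 2) / q = pi / 2"
      using q by (simp_all only: diff_divide_distrib right_diff_distrib) simp_all
    have "f (q div 2) = sin (pi / 2 - pi * (c * frac (real (q div 2) * \<theta>)) / q) / sin (pi / 2)"
      unfolding f_def eqs ..
    then show ?thesis by (simp add: sin_diff)
  qed simp
  finally show ?thesis
    using sine_prod_cf_q[of n] unfolding q_def[symmetric] \<theta>_def[symmetric] c_def[symmetric] by simp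
qed

end

section \<open>Convergence along the subsequence\<close>

context badly_approximable
begin

lemma convergent_sine_prod:
  fixes n :: "nat \<Rightarrow> nat"
  assumes n: "strict_mono n" "\<And>i. 0 < n i"
    and plus: "convergent (\<lambda>i. alpha_plus \<alpha> (n i))"
    and minus: "convergent (\<lambda>i. alpha_minus \<alpha> (n i))"
  shows "\<exists>C > 0. (\<lambda>i. sine_prod (cf_q \<alpha> (n i)) \<alpha>) \<longlonglongrightarrow> C"
proof -
  define \<kappa> where "\<kappa> = 1 / (4 * (real B + 1))"
  have \<kappa>: "0 < \<kappa>" unfolding \<kappa>_def by simp
  define m where "m = (\<lambda>i. n i - 1)"
  have n_m: "n i = Suc (m i)" for i using n(2)[of i] unfolding m_def by simp
  define q where "q = (\<lambda>i. cf_q \<alpha> (n i))"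
  define \<theta> where "\<theta> = (\<lambda>i. cf_q \<alpha> (m i) / q i)"
  define c where "c = (\<lambda>i. q i * cf_delta \<alpha> (n i))"
  have q_pos: "0 < q i" for i unfolding q_def n_m by (rule cf_q_pos)
  have c_bounds: "0 < c i" "c i < 1" for i unfolding c_def q_def n_m by (rule cf_q_delta_bounds)+
  have bad: "\<kappa> / b \<le> \<bar>of_int b * \<theta> i - of_int a\<bar>" if "0 < b" "b < int (q i)" for a b i
    using badly_approximable_cf_q[of b "m i" a] that unfolding \<kappa>_def \<theta>_def q_def n_m by simp
  have q_lim: "filterlim q at_top sequentially"
  proof (rule filterlim_at_top_mono[OF filterlim_minus_const_nat_at_top[of 1]], rule always_eventually, rule allI)
    fix i
    have "i \<le> n i" using n(1) by (simp add: strict_mono_imp_increasing)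
    then show "i - 1 \<le> q i" using cf_q_ge[of "m i"] unfolding q_def n_m by linarith
  qed
  obtain A where A: "(\<lambda>i. alpha_plus \<alpha> (n i)) \<longlonglongrightarrow> A" using plus unfolding convergent_def by blast
  obtain \<beta> where "(\<lambda>i. alpha_minus \<alpha> (n i)) \<longlonglongrightarrow> \<beta>" using minus unfolding convergent_def by blast
  then have \<beta>: "\<theta> \<longlonglongrightarrow> \<beta>" unfolding \<theta>_def q_def n_m alpha_minus_eq .
  have A1: "1 \<le> A"
  proof (rule LIMSEQ_le_const[OF A], intro exI allI impI)
    show "1 \<le> alpha_plus \<alpha> (n i)" for i
      unfolding n_m alpha_plus_eq using cf_rem_pos[of "m i"] cf_rem_less_1[of "m i"] by simp
  qed
  have \<beta>0: "0 \<le> \<beta>" by (rule LIMSEQ_le_const[OF \<beta>]) (auto simp: \<theta>_def)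
  define c' where "c' = 1 / (A + \<beta>)"
  \<comment> \<open>Positivity of c' will make the limit constant positive; of the strict bound c i
    < 1, the weak form c' <= 1 is all that is claimed in the limit.\<close>
  have c': "0 < c'" "c' \<le> 1" unfolding c'_def using A1 \<beta>0 by auto
  have c_lim: "c \<longlonglongrightarrow> c'"
  proof -
    have "c = (\<lambda>i. 1 / (alpha_plus \<alpha> (n i) + \<theta> i))"
      unfolding c_def q_def \<theta>_def n_m cf_q_times_delta alpha_minus_eq ..
    then show ?thesis unfolding c'_def using A1 \<beta>0 by (auto intro!: tendsto_intros A \<beta>)
  qed
  \<comment> \<open>Every fixed k is eventually below q i, so the lower bound \<kappa> / k survives
    the limit. Hence \<open>frac\<close> is continuous at k * \<beta> and each paired factor
    converges.\<close>
  have not_int: "real k * \<beta> \<notin> \<int>" if k: "1 \<le> k" for k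
  proof
    assume "real k * \<beta> \<in> \<int>"
    then obtain a where a: "real k * \<beta> = of_int a" by (auto elim: Ints_cases)
    have "(\<lambda>i. \<bar>real k * \<theta> i - of_int a\<bar>) \<longlonglongrightarrow> \<bar>real k * \<beta> - of_int a\<bar>"
      by (intro tendsto_intros \<beta>)
    moreover have "\<forall>\<^sub>F i in sequentially. k < q i"
      using q_lim unfolding filterlim_at_top by (simp add: Suc_le_eq[symmetric])
    then have "\<forall>\<^sub>F i in sequentially. \<kappa> / k \<le> \<bar>real k * \<theta> i - of_int a\<bar>"
      by eventually_elim (use bad[of "int k"] k in auto)
    ultimately have "\<kappa> / k \<le> \<bar>real k * \<beta> - of_int a\<bar>"
      by (rule tendsto_lowerbound) simp
    then show False using a \<kappa> k by (simp add: field_simps)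
  qed
  define f where "f = (\<lambda>i k. ln (pair_ratio (q i) (c i) (frac (real k * \<theta> i)) k))"
  define L where "L = (\<lambda>i. (q i - 1) div 2)"
  have "convergent (\<lambda>i. \<Sum>k=1..L i. f i k)"
  proof (rule convergent_sum_uniform_tails)
    fix k :: nat assume k: "1 \<le> k"
    have "(\<lambda>i. frac (real k * \<theta> i)) \<longlonglongrightarrow> frac (real k * \<beta>)"
      by (rule isCont_tendsto_compose[OF continuous_frac[OF not_int[OF k]]]) (intro tendsto_intros \<beta>)
    then show "convergent (\<lambda>i. f i k)"
      unfolding f_def using k c' by (intro convergent_ln_pair_ratio[OF q_lim c_lim]) (auto simp: frac_lt_1)
  next
    show "filterlim L at_top sequentially"
      unfolding filterlim_at_top
    proof
      fix Z
      have "\<forall>\<^sub>F i in sequentially. 2 * Z + 1 \<le> q i" using q_lim unfolding filterlim_at_top by blast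
      then show "\<forall>\<^sub>F i in sequentially. Z \<le> L i" by eventually_elim (simp add: L_def)
    qed
  next
    fix M :: nat assume M: "1 \<le> M"
    show "\<forall>\<^sub>F i in sequentially. \<bar>\<Sum>k=Suc M..L i. f i k\<bar> \<le> (96 * (10 / \<kappa> + 1) + 64) / sqrt M"
    proof (intro always_eventually allI)
      fix i
      have "2 * L i < q i" unfolding L_def using q_pos[of i] by linarith
      then show "\<bar>\<Sum>k=Suc M..L i. f i k\<bar> \<le> (96 * (10 / \<kappa> + 1) + 64) / sqrt M"
        unfolding f_def using bad \<kappa> c_bounds[of i] M by (intro ln_pair_ratio_tail) auto
    qed
  next
    have "filterlim (\<lambda>M. sqrt (real M)) at_top sequentially"
      by (rule filterlim_compose[OF sqrt_at_top filterlim_real_sequentially])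
    then show "(\<lambda>M. (96 * (10 / \<kappa> + 1) + 64) / sqrt (real M)) \<longlonglongrightarrow> 0"
      by (rule real_tendsto_divide_at_top[OF tendsto_const])
  qed
  then obtain F where F: "(\<lambda>i. \<Sum>k=1..L i. f i k) \<longlonglongrightarrow> F" unfolding convergent_def by blast
  define mid where "mid = (\<lambda>i. if even (q i) then cos (pi * (c i * frac (real (q i div 2) * \<theta> i)) / q i) else 1)"
  have q_real: "filterlim (\<lambda>i. real (q i)) at_top sequentially"
    by (rule filterlim_compose[OF filterlim_real_sequentially q_lim])
  \<comment> \<open>The cosine argument is at most pi / q i, so the parity of q i has no influence
    on the limit.\<close>
  have mid_lim: "mid \<longlonglongrightarrow> 1"
  proof -
    have "(\<lambda>i. pi * (c i * frac (real (q i div 2) * \<theta> i)) / q i) \<longlonglongrightarrow> 0"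
    proof (rule Lim_null_comparison)
      show "(\<lambda>i. pi / real (q i)) \<longlonglongrightarrow> 0" by (rule real_tendsto_divide_at_top[OF tendsto_const q_real])
      have "norm (pi * (c i * frac (real (q i div 2) * \<theta> i)) / q i) \<le> pi / q i" for i
      proof -
        have "c i * frac (real (q i div 2) * \<theta> i) \<le> 1 * 1"
          using c_bounds[of i] frac_lt_1[of "real (q i div 2) * \<theta> i"] by (intro mult_mono) auto
        then have "pi * (c i * frac (real (q i div 2) * \<theta> i)) \<le> pi" by simp
        then show ?thesis using c_bounds[of i] by (simp add: abs_mult divide_right_mono)
      qed
      then show "\<forall>\<^sub>F i in sequentially. norm (pi * (c i * frac (real (q i div 2) * \<theta> i)) / q i) \<le> pi / q i"
        by simp
    qed
    then have "(\<lambda>i. cos (pi * (c i * frac (real (q i div 2) * \<theta> i)) / q i)) \<longlonglongrightarrow> cos 0"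
      by (rule tendsto_cos)
    then have "(\<lambda>i. if even (q i) then cos (pi * (c i * frac (real (q i div 2) * \<theta> i)) / q i) else 1) \<longlonglongrightarrow> 1"
      by (intro filterlim_If) (auto intro: tendsto_mono[OF inf_le1])
    then show ?thesis unfolding mid_def .
  qed
  have "sine_prod (q i) \<alpha> = 2 * (q i * sin (pi * c i / q i)) * (exp (\<Sum>k=1..L i. f i k) * mid i)" for i
  proof -
    have "exp (f i k) = pair_ratio (q i) (c i) (frac (real k * \<theta> i)) k" if "k \<in> {1..L i}" for k
    proof -
      have k: "1 \<le> k" "2 * k < q i" using that q_pos[of i] unfolding L_def by auto
      have "0 < \<kappa> / k" using \<kappa> k by simp
      also have "\<dots> \<le> \<bar>of_int (int k) * \<theta> i - of_int \<lfloor>real k * \<theta> i\<rfloor>\<bar>"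
        using bad[of "int k" i "\<lfloor>real k * \<theta> i\<rfloor>"] k by simp
      finally have "0 < frac (real k * \<theta> i)" by (simp add: frac_def)
      then have "0 < pair_ratio (q i) (c i) (frac (real k * \<theta> i)) k"
        using k c_bounds[of i] frac_lt_1 by (intro pair_ratio_pos) auto
      then show ?thesis unfolding f_def by simp
    qed
    then have "exp (\<Sum>k=1..L i. f i k) = (\<Prod>k=1..L i. pair_ratio (q i) (c i) (frac (real k * \<theta> i)) k)"
      by (simp add: exp_sum)
    then show ?thesis
      using sine_prod_cf_q_pairing[of "m i"]
      unfolding mid_def L_def c_def \<theta>_def q_def n_m by simp
  qed
  \<comment> \<open>Working with logarithms makes the limit of the paired product an exponential, so
    it cannot be zero.\<close>
  moreover have "(\<lambda>i. 2 * (q i * sin (pi * c i / q i)) * (exp (\<Sum>k=1..L i. f i k) * mid i))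
      \<longlonglongrightarrow> 2 * (pi * c') * (exp F * 1)"
    by (intro tendsto_intros tendsto_scaled_sin q_real c_lim F mid_lim)
  ultimately have "(\<lambda>i. sine_prod (q i) \<alpha>) \<longlonglongrightarrow> 2 * (pi * c') * (exp F * 1)" by simp
  moreover have "0 < 2 * (pi * c') * (exp F * 1)" using c' by simp
  ultimately show ?thesis unfolding q_def by blast
qed

end

theorem theorem1p5:
  fixes \<alpha> :: real and n :: "nat \<Rightarrow> nat"
  assumes "0 < \<alpha>" "\<alpha> < 1" "\<alpha> \<notin> \<rat>"
    and "\<exists>B. \<forall>k\<ge>1. cf_a \<alpha> k \<le> B"
    and "strict_mono n" "\<forall>i. 0 < n i"
    and "convergent (\<lambda>i. alpha_plus \<alpha> (n i))"
    and "convergent (\<lambda>i. alpha_minus \<alpha> (n i))"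
  shows "\<exists>C > 0. (\<lambda>i. sine_prod (cf_q \<alpha> (n i)) \<alpha>) \<longlonglongrightarrow> C"
proof -
  obtain B where "\<forall>k\<ge>1. cf_a \<alpha> k \<le> B" using assms(4) by blast
  then interpret badly_approximable \<alpha> B using assms(1-3) by unfold_locales auto
  show ?thesis using assms(5-8) by (intro convergent_sine_prod) auto
qed

end
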